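(* Let $(\alpha,\beta)\in\mathcal I$ and let $(\tilde\alpha_j,\tilde\beta_j)\in\mathcal I$, $j=1,\dots,M$, $M\in\mathbb N\cup\{\infty\}$, be all the intervals of $\mathcal I$ with $\tilde\alpha_j<\alpha$. Let $t\in[\alpha,\beta]$. Then, almost surely, $$X(t)=X(0)+\int_0^t(k-aX(s))\,ds+\sigma\int_{[0,\beta_0)\cup\left(\bigcup_{j=1}^M(\tilde\alpha_j,\tilde\beta_j)\right)\cup[\alpha,t)}\sqrt{X(s)}\circ dB^H(s),$$ where $$\int_{[0,\beta_0)\cup\left(\bigcup_{j=1}^M(\tilde\alpha_j,\tilde\beta_j)\right)\cup[\alpha,t)}\sqrt{X(s)}\circ dB^H(s):=\int_0^{\beta_0}\sqrt{X(s)}\circ dB^H(s)+\sum_{j=1}^M\int_{\tilde\alpha_j}^{\tilde\beta_j}\sqrt{X(s)}\circ dB^H(s)+\int_\alpha^t\sqrt{X(s)}\circ dB^H(s)$$ and the integrals on the right-hand side are pathwise Stratonovich integrals.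
   Context: $B^H=\{B^H(t),t\ge0\}$ is a fractional Brownian motion with Hurst index $H\in(0,1/2)$ on a probability space $(\Omega,\mathcal F,\mathbb P)$, i.e. a centered Gaussian process with covariance $\mathbb E[B^H(t)B^H(s)]=\frac12(t^{2H}+s^{2H}-|t-s|^{2H})$ and continuous paths starting at $0$. $Y_0,k,a,\sigma>0$ are constants. For $\varepsilon>0$, $Y_\varepsilon=\{Y_\varepsilon(t),t\ge0\}$ is the unique (pathwise, continuous) solution of $$Y_\varepsilon(t)=Y_0+\frac12\int_0^t\Big(\frac{k}{Y_\varepsilon(s)\mathbf 1_{\{Y_\varepsilon(s)>0\}}+\varepsilon}-aY_\varepsilon(s)\Big)ds+\frac{\sigma}{2}B^H(t),\quad t\ge0.$$ $Y_\varepsilon(t)$ increases as $\varepsilon$ decreases, and $Y(t)=\lim_{\varepsilon\downarrow0}Y_\varepsilon(t)$, $t\ge0$, is the pointwise limit. Only finite and locally Lebesgue integrable paths of $Y$ are considered (this excludes only a null set). The fractional Cox–Ingersoll–Ross process is $X(t)=Y^2(t)$, $t\ge0$. Almost surely $Y\ge0$, $Y>0$ a.e., and the set $\{t>0\mid Y(t)>0\}$ is open in $\mathbb R$; hence the positivity set is a.s. represented as $$\{t\ge0\mid Y(t)>0\}=[\alpha_0,\beta_0)\cup\Big(\bigcup_{i=1}^N(\alpha_i,\beta_i)\Big),\qquad N\in\mathbb N\cup\{\infty\},$$ where $\alpha_0=0$, $\beta_0$ is the first moment at which $Y$ hits zero, and the (random, pathwise defined) intervals $(\alpha_i,\beta_i)$,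 $i\ge1$, are pairwise disjoint and disjoint from $[\alpha_0,\beta_0)$ (they are the connected components of the positivity set). The endpoints are treated as real (finite) numbers. $\mathcal I=\{(\alpha_i,\beta_i),\ i=1,\dots,N\}$ is the set of these open intervals (it does not contain $[0,\beta_0)$). The sum over $j$ is zero if there are no such intervals. Pathwise Stratonovich integral: for random processes $U,V$ and $u\le v$, $\int_u^vU_s\circ dV_s$ is the pathwise limit of the sums $\sum_{j=1}^n\frac{U_{t_j}+U_{t_{j-1}}}{2}(V_{t_j}-V_{t_{j-1}})$ as the mesh of the partition $u=t_0<t_1<\dots<t_n=v$ tends to zero, if this limit exists. *)

theory Defs
  imports "HOL-Probability.Probability"
begin

definition gaussian_rv :: "'a measure \<Rightarrow> ('a \<Rightarrow> real) \<Rightarrow> bool" where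
  "gaussian_rv M Z \<longleftrightarrow> Z \<in> borel_measurable M \<and>
     (\<exists>\<mu> s. s \<ge> 0 \<and>
        (if s = 0 then (AE \<omega> in M. Z \<omega> = \<mu>) else distributed M lborel Z (normal_density \<mu> s)))"

text \<open>Joint normality of the finite-dimensional distributions is expressed by normality
  (possibly degenerate) of all finite linear combinations.\<close>

definition gaussian_process :: "'a measure \<Rightarrow> real set \<Rightarrow> (real \<Rightarrow> 'a \<Rightarrow> real) \<Rightarrow> bool" where
  "gaussian_process M T Z \<longleftrightarrow>
     (\<forall>S c. finite S \<and> S \<subseteq> T \<longrightarrow> gaussian_rv M (\<lambda>\<omega>. \<Sum>s\<in>S. c s * Z s \<omega>))"

definition fractional_brownian_motion ::
  "'a measure \<Rightarrow> real \<Rightarrow> (real \<Rightarrow> 'a \<Rightarrow> real) \<Rightarrow> bool" where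
  "fractional_brownian_motion M H B \<longleftrightarrow>
     gaussian_process M {0..} B \<and>
     (\<forall>t\<ge>0. prob_space.expectation M (B t) = 0) \<and>
     (\<forall>t\<ge>0. \<forall>s\<ge>0. prob_space.expectation M (\<lambda>\<omega>. B t \<omega> * B s \<omega>) =
        (t powr (2 * H) + s powr (2 * H) - \<bar>t - s\<bar> powr (2 * H)) / 2) \<and>
     (\<forall>\<omega>\<in>space M. B 0 \<omega> = 0 \<and> continuous_on {0..} (\<lambda>t. B t \<omega>))"

text \<open>The path \<open>y\<close> is a continuous solution, on \<open>t \<ge> 0\<close>, of the \<open>\<epsilon>\<close>-regularised equation
  driven by the path \<open>b\<close>.\<close>

definition regularized_solution ::
  "real \<Rightarrow> real \<Rightarrow> real \<Rightarrow> real \<Rightarrow> real \<Rightarrow> (real \<Rightarrow> real) \<Rightarrow> (real \<Rightarrow> real) \<Rightarrow> bool" where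
  "regularized_solution Y0 k a \<sigma> \<epsilon> b y \<longleftrightarrow>
     continuous_on {0..} y \<and>
     (\<forall>t\<ge>0. y t = Y0 +
        1 / 2 * (LBINT s:{0..t}. k / (y s * indicator {0<..} (y s) + \<epsilon>) - a * y s) +
        \<sigma> / 2 * b t)"

text \<open>The open components with finite endpoints of \<open>{t \<ge> 0. y t > 0}\<close>.  A component containing
  \<open>0\<close>, such as \<open>[0, \<beta>\<^sub>0)\<close>, has a least element and so is not of the form \<open>(\<alpha>, \<beta>)\<close>.\<close>

definition excursions :: "(real \<Rightarrow> real) \<Rightarrow> (real \<times> real) set" where
  "excursions y = {(\<alpha>, \<beta>). \<alpha> < \<beta> \<and> {\<alpha><..<\<beta>} \<in> components {t. 0 \<le> t \<and> 0 < y t}}"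

definition excursions_before :: "(real \<Rightarrow> real) \<Rightarrow> real \<Rightarrow> (real \<times> real) set" where
  "excursions_before y \<alpha> = {(u, v) \<in> excursions y. u < \<alpha>}"

definition first_zero :: "(real \<Rightarrow> real) \<Rightarrow> real" where
  "first_zero y = Inf {t. 0 \<le> t \<and> y t = 0}"

text \<open>For \<open>u = v\<close> the only partition has \<open>n = 0\<close>.\<close>

definition interval_partition :: "real \<Rightarrow> real \<Rightarrow> nat \<Rightarrow> (nat \<Rightarrow> real) \<Rightarrow> bool" where
  "interval_partition u v n p \<longleftrightarrow> p 0 = u \<and> p n = v \<and> (\<forall>j<n. p j < p (Suc j))"

definition stratonovich_sum ::
  "(real \<Rightarrow> real) \<Rightarrow> (real \<Rightarrow> real) \<Rightarrow> nat \<Rightarrow> (nat \<Rightarrow> real) \<Rightarrow> real" where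
  "stratonovich_sum U V n p =
     (\<Sum>j=1..n. (U (p j) + U (p (j - 1))) / 2 * (V (p j) - V (p (j - 1))))"

definition has_stratonovich_integral ::
  "(real \<Rightarrow> real) \<Rightarrow> (real \<Rightarrow> real) \<Rightarrow> real \<Rightarrow> real \<Rightarrow> real \<Rightarrow> bool" where
  "has_stratonovich_integral U V u v I \<longleftrightarrow> u \<le> v \<and>
     (\<forall>e>0. \<exists>\<delta>>0. \<forall>n p.
        interval_partition u v n p \<and> (\<forall>j<n. p (Suc j) - p j < \<delta>) \<longrightarrow>
        \<bar>stratonovich_sum U V n p - I\<bar> < e)"

definition stratonovich_integrable ::
  "(real \<Rightarrow> real) \<Rightarrow> (real \<Rightarrow> real) \<Rightarrow> real \<Rightarrow> real \<Rightarrow> bool" where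
  "stratonovich_integrable U V u v \<longleftrightarrow> (\<exists>I. has_stratonovich_integral U V u v I)"

definition stratonovich_integral ::
  "(real \<Rightarrow> real) \<Rightarrow> (real \<Rightarrow> real) \<Rightarrow> real \<Rightarrow> real \<Rightarrow> real" where
  "stratonovich_integral U V u v = (THE I. has_stratonovich_integral U V u v I)"

text \<open>The integral over \<open>[0, \<beta>\<^sub>0) \<union> \<Union>J \<union> [\<alpha>, t)\<close>, \<open>J\<close> being a finite or infinite family of
  intervals given by their endpoints.  The enumeration of \<open>J\<close> being arbitrary, the sum is
  unordered; \<open>stratonovich_integrable_over\<close> says that all terms exist and that the sum over
  \<open>J\<close> converges (unconditionally).\<close>

definition stratonovich_integrable_over ::
  "(real \<Rightarrow> real) \<Rightarrow> (real \<Rightarrow> real) \<Rightarrow> real \<Rightarrow> (real \<times> real) set \<Rightarrow> real \<Rightarrow> real \<Rightarrow> bool" where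
  "stratonovich_integrable_over U V \<beta>0 J \<alpha> t \<longleftrightarrow>
     stratonovich_integrable U V 0 \<beta>0 \<and>
     (\<forall>(u, v)\<in>J. stratonovich_integrable U V u v) \<and>
     (\<lambda>(u, v). stratonovich_integral U V u v) summable_on J \<and>
     stratonovich_integrable U V \<alpha> t"

definition stratonovich_integral_over ::
  "(real \<Rightarrow> real) \<Rightarrow> (real \<Rightarrow> real) \<Rightarrow> real \<Rightarrow> (real \<times> real) set \<Rightarrow> real \<Rightarrow> real \<Rightarrow> real" where
  "stratonovich_integral_over U V \<beta>0 J \<alpha> t =
     stratonovich_integral U V 0 \<beta>0 +
     (\<Sum>\<^sub>\<infinity>(u, v)\<in>J. stratonovich_integral U V u v) +
     stratonovich_integral U V \<alpha> t"

end

theory Submission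
  imports Defs
begin

text \<open>The argument is pathwise.  Comparison makes \<open>y \<epsilon>\<close> increase as \<open>\<epsilon>\<close> decreases;
  as the drift is bounded above wherever \<open>y \<epsilon>\<close> is bounded away from \<open>0\<close>, one gets a bound and one-sided moduli of continuity uniform in
  \<open>\<epsilon>\<close>, so that \<open>Y\<close> is continuous.  The integrals \<open>\<integral> k / (y\<^sup>+ + \<epsilon>)\<close> stay bounded, which
  forces \<open>Y \<ge> 0\<close> and a Lebesgue null zero set, and half of them converges to a nondecreasing \<open>G\<close> with
  \<open>dY = dG - (a / 2) Y dt + (\<sigma> / 2) db\<close>.  Since \<open>Y dG = (k / 2) dt\<close> holds across the zeros of \<open>Y\<close>
  as well, the midpoint sums of \<open>\<sigma> \<integral> Y \<circ> db\<close> telescope up to a vanishing error: on every interval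
  \<open>[u, v]\<close> the integral exists and \<open>\<sigma> \<integral> Y \<circ> db = Y\<^sup>2(v) - Y\<^sup>2(u) - \<integral> (k - a Y\<^sup>2) ds\<close>.  On a complete
  excursion the boundary terms vanish, and the excursions before \<open>\<alpha>\<close> exhaust \<open>[\<beta>\<^sub>0, \<alpha>]\<close>
  up to a null set.\<close>

section \<open>Stratonovich integrals and excursions\<close>

lemma interval_partition_le:
  assumes "interval_partition u v n p" and "i \<le> j" and "j \<le> n"
  shows "p i \<le> p j"
  using assms(2,3)
proof (induction rule: dec_induct)
  case (step m)
  then have "p m < p (Suc m)" using assms(1) by (simp add: interval_partition_def)
  then show ?case using step by simp
qed simp

text \<open>\<open>E\<close> acts as a control: each local error is at most a small multiple of an
  increment of \<open>E\<close>, and over a partition the increments of \<open>E\<close> and of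
  \<open>F\<close> both telescope, so the total error stays small however many points there
  are.\<close>

lemma has_stratonovich_integral_telescope:
  assumes "u \<le> v" and E_mono: "E u \<le> E v"
    and approx: "\<And>e. 0 < e \<Longrightarrow> \<exists>\<delta>>0. \<forall>s t. u \<le> s \<and> s \<le> t \<and> t \<le> v \<and> t - s < \<delta> \<longrightarrow>
      \<bar>(U t + U s) / 2 * (V t - V s) - (F t - F s)\<bar> \<le> e * (E t - E s)"
  shows "has_stratonovich_integral U V u v (F v - F u)"
  unfolding has_stratonovich_integral_def
proof (intro conjI allI impI assms(1))
  fix e :: real assume "0 < e"
  \<comment> \<open>The \<open>+ 1\<close> keeps the denominator positive and the final estimate
    strict even if \<open>E u = E v\<close>.\<close>
  define e' where "e' = e / (E v - E u + 1)"
  have "0 < e'" using \<open>0 < e\<close> E_mono by (simp add: e'_def)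
  then obtain \<delta> where \<delta>: "0 < \<delta>" "\<And>s t. u \<le> s \<Longrightarrow> s \<le> t \<Longrightarrow> t \<le> v \<Longrightarrow> t - s < \<delta> \<Longrightarrow>
      \<bar>(U t + U s) / 2 * (V t - V s) - (F t - F s)\<bar> \<le> e' * (E t - E s)"
    using approx by meson
  have "\<bar>stratonovich_sum U V n p - (F v - F u)\<bar> < e"
    if p: "interval_partition u v n p" "\<forall>j<n. p (Suc j) - p j < \<delta>" for n p
  proof -
    have ends: "p 0 = u" "p n = v" using p(1) by (auto simp: interval_partition_def)
    have telescope: "(\<Sum>j<n. f (p (Suc j)) - f (p j)) = f v - f u" for f :: "real \<Rightarrow> real"
      using sum_lessThan_telescope[of "\<lambda>j. f (p j)" n] ends by simp
    have "stratonovich_sum U V n p - (F v - F u) =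
        (\<Sum>j<n. (U (p (Suc j)) + U (p j)) / 2 * (V (p (Suc j)) - V (p j)) - (F (p (Suc j)) - F (p j)))"
      by (simp only: stratonovich_sum_def telescope[of F, symmetric] sum_subtractf[symmetric]
          One_nat_def sum.atLeast1_atMost_eq diff_Suc_Suc diff_zero)
    also have "\<bar>\<dots>\<bar> \<le> (\<Sum>j<n. e' * (E (p (Suc j)) - E (p j)))"
    proof (rule order_trans[OF sum_abs sum_mono])
      fix j assume "j \<in> {..<n}"
      then show "\<bar>(U (p (Suc j)) + U (p j)) / 2 * (V (p (Suc j)) - V (p j)) - (F (p (Suc j)) - F (p j))\<bar>
          \<le> e' * (E (p (Suc j)) - E (p j))"
        using interval_partition_le[OF p(1), of 0 j] interval_partition_le[OF p(1), of j "Suc j"]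
          interval_partition_le[OF p(1), of "Suc j" n] p(2) ends
        by (intro \<delta>(2)) auto
    qed
    also have "\<dots> = e' * (E v - E u)" by (simp add: telescope flip: sum_distrib_left)
    also have "\<dots> < e" using \<open>0 < e\<close> E_mono by (simp add: e'_def field_simps)
    finally show ?thesis .
  qed
  then show "\<exists>\<delta>>0. \<forall>n p. interval_partition u v n p \<and> (\<forall>j<n. p (Suc j) - p j < \<delta>) \<longrightarrow>
      \<bar>stratonovich_sum U V n p - (F v - F u)\<bar> < e"
    using \<delta>(1) by blast
qed

text \<open>Arbitrarily fine partitions keep the limit condition from being vacuous; uniqueness of
  the integral rests on this.\<close>

lemma fine_interval_partition_exists:
  assumes "u \<le> v" and "0 < \<delta>"
  obtains n p where "interval_partition u v n p" "\<forall>j<n. p (Suc j) - p j < \<delta>"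
proof (cases "u = v")
  case True
  then show thesis using that[of 0 "\<lambda>_. u"] by (simp add: interval_partition_def)
next
  case False
  obtain n :: nat where n: "(v - u) / \<delta> < real n" using reals_Archimedean2 by blast
  moreover have "0 < (v - u) / \<delta>" using False assms by simp
  ultimately have n0: "0 < real n" by linarith
  define p where "p j = u + real j * ((v - u) / n)" for j
  have step: "p (Suc j) - p j = (v - u) / n" for j by (simp add: p_def distrib_right flip: diff_divide_distrib)
  have "0 < (v - u) / n" using False assms n0 by simp
  then have "p j < p (Suc j)" for j using step[of j] by linarith
  moreover have "(v - u) / n < \<delta>" using n n0 assms by (simp add: field_simps)
  ultimately show thesis
    using that[of n p] n0 step by (auto simp: interval_partition_def p_def)
qed

lemma has_stratonovich_integral_unique:
  assumes "has_stratonovich_integral U V u v I" and "has_stratonovich_integral U V u v J"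
  shows "I = J"
proof (rule ccontr)
  assume "I \<noteq> J"
  define e where "e = \<bar>I - J\<bar> / 2"
  have "0 < e" using \<open>I \<noteq> J\<close> by (simp add: e_def)
  obtain \<delta>1 where \<delta>1: "0 < \<delta>1" "\<And>n p. interval_partition u v n p \<Longrightarrow>
      (\<forall>j<n. p (Suc j) - p j < \<delta>1) \<Longrightarrow> \<bar>stratonovich_sum U V n p - I\<bar> < e"
    using assms(1) \<open>0 < e\<close> unfolding has_stratonovich_integral_def by blast
  obtain \<delta>2 where \<delta>2: "0 < \<delta>2" "\<And>n p. interval_partition u v n p \<Longrightarrow>
      (\<forall>j<n. p (Suc j) - p j < \<delta>2) \<Longrightarrow> \<bar>stratonovich_sum U V n p - J\<bar> < e"
    using assms(2) \<open>0 < e\<close> unfolding has_stratonovich_integral_def by blast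
  have "u \<le> v" using assms(1) by (simp add: has_stratonovich_integral_def)
  with \<delta>1(1) \<delta>2(1) obtain n p where "interval_partition u v n p" "\<forall>j<n. p (Suc j) - p j < min \<delta>1 \<delta>2"
    using fine_interval_partition_exists[of u v "min \<delta>1 \<delta>2"] by (metis min_less_iff_conj)
  then have "\<bar>stratonovich_sum U V n p - I\<bar> < e" "\<bar>stratonovich_sum U V n p - J\<bar> < e"
    using \<delta>1(2) \<delta>2(2) by auto
  then show False by (auto simp: e_def abs_if split: if_splits)
qed

lemma stratonovich_integral_eqI:
  assumes "has_stratonovich_integral U V u v I"
  shows "stratonovich_integral U V u v = I" and "stratonovich_integrable U V u v"
  using assms has_stratonovich_integral_unique[OF _ assms]
  unfolding stratonovich_integral_def stratonovich_integrable_def by (blast intro: the_equality)+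

section \<open>Excursions of a nonnegative function\<close>

text \<open>Both directions are maximality of a component: if \<open>f\<close> were positive at an
  endpoint, that endpoint could be added; conversely a connected positivity set leaving the interval
  would contain an endpoint, where \<open>f\<close> vanishes.\<close>

lemma excursions_iff:
  assumes nonneg: "\<And>t. 0 \<le> t \<Longrightarrow> 0 \<le> f t"
  shows "(u, v) \<in> excursions f \<longleftrightarrow>
    0 \<le> u \<and> u < v \<and> f u = 0 \<and> f v = 0 \<and> (\<forall>s\<in>{u<..<v}. 0 < f s)"
    (is "?L \<longleftrightarrow> ?R")
proof
  assume ?L
  then have "u < v" and sub: "{u<..<v} \<subseteq> {t. 0 \<le> t \<and> 0 < f t}"
    and maximal: "\<And>D. D \<noteq> {} \<Longrightarrow> {u<..<v} \<subseteq> D \<Longrightarrow> D \<subseteq> {t. 0 \<le> t \<and> 0 < f t} \<Longrightarrow> connected D \<Longrightarrow>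
      D = {u<..<v}"
    by (auto simp: excursions_def in_components_maximal)
  have "0 \<le> u"
  proof (rule ccontr)
    assume "\<not> 0 \<le> u"
    moreover from this obtain s where "u < s" "s < min 0 v" using dense[of u "min 0 v"] \<open>u < v\<close> by auto
    ultimately show False using sub by (auto dest!: subsetD[where c = s])
  qed
  have "f u = 0"
  proof (rule ccontr)
    assume "f u \<noteq> 0"
    then have "0 < f u" using nonneg[of u] \<open>0 \<le> u\<close> \<open>u < v\<close> by simp
    then have "{u..<v} \<subseteq> {t. 0 \<le> t \<and> 0 < f t}"
      using sub \<open>0 \<le> u\<close> \<open>u < v\<close> by (auto simp: subset_iff le_less)
    then have "{u..<v} = {u<..<v}"
      using \<open>u < v\<close> by (intro maximal) auto
    then show False using \<open>u < v\<close> by auto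
  qed
  have "f v = 0"
  proof (rule ccontr)
    assume "f v \<noteq> 0"
    then have "0 < f v" using nonneg[of v] \<open>0 \<le> u\<close> \<open>u < v\<close> by simp
    then have "{u<..v} \<subseteq> {t. 0 \<le> t \<and> 0 < f t}"
      using sub \<open>0 \<le> u\<close> \<open>u < v\<close> by (auto simp: subset_iff le_less)
    then have "{u<..v} = {u<..<v}"
      using \<open>u < v\<close> by (intro maximal) auto
    then show False using \<open>u < v\<close> by auto
  qed
  show ?R using \<open>0 \<le> u\<close> \<open>u < v\<close> \<open>f u = 0\<close> \<open>f v = 0\<close> sub by auto
next
  assume R: ?R
  have "D \<subseteq> {u<..<v}" if D: "{u<..<v} \<subseteq> D" "D \<subseteq> {t. 0 \<le> t \<and> 0 < f t}" "connected D" for D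
  proof
    fix s assume "s \<in> D"
    obtain m where "u < m" "m < v" using dense[of u v] R by blast
    then have "m \<in> D" using D(1) by auto
    have "u \<notin> D" "v \<notin> D" using R D(2) by auto
    then have "\<not> s \<le> u" and "\<not> v \<le> s"
      using connectedD_interval[OF D(3) \<open>s \<in> D\<close> \<open>m \<in> D\<close>, of u]
        connectedD_interval[OF D(3) \<open>m \<in> D\<close> \<open>s \<in> D\<close>, of v] \<open>u < m\<close> \<open>m < v\<close>
      by auto
    then show "s \<in> {u<..<v}" by simp
  qed
  then show ?L using R by (fastforce simp: excursions_def in_components_maximal)
qed

lemma excursions_disjoint:
  assumes "\<And>t. 0 \<le> t \<Longrightarrow> 0 \<le> f t" and "(u, v) \<in> excursions f" and "(u', v') \<in> excursions f" and "u < u'"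
  shows "v \<le> u'"
proof (rule ccontr)
  assume "\<not> v \<le> u'"
  then have "u' \<in> {u<..<v}" using assms(4) by simp
  moreover have "\<forall>s\<in>{u<..<v}. 0 < f s" "f u' = 0"
    using assms(2,3) excursions_iff[of f, OF assms(1)] by auto
  ultimately show False by fastforce
qed

text \<open>Countable additivity in unordered form, to match the sum over excursions, which come
  without an enumeration. Absolute convergence, obtained from the integral of
  \<open>norm (f x)\<close>, makes the order irrelevant.\<close>

lemma has_sum_integral_disjoint:
  fixes f :: "'b \<Rightarrow> 'c :: {banach, second_countable_topology}" and I :: "'i \<Rightarrow> 'b set"
  assumes "countable J" and meas: "\<And>i. i \<in> J \<Longrightarrow> I i \<in> sets M"
    and disj: "disjoint_family_on I J" and int: "set_integrable M (\<Union>i\<in>J. I i) f"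
  shows "((\<lambda>i. LINT x:I i|M. f x) has_sum (LINT x:(\<Union>i\<in>J. I i)|M. f x)) J"
proof -
  define N where "N = to_nat_on J ` J"
  \<comment> \<open>Indices outside the range of the enumeration get the empty set, so finite and
    infinite \<open>J\<close> are treated alike.\<close>
  define A where "A n = (if n \<in> N then I (from_nat_into J n) else {})" for n
  have bij: "bij_betw (from_nat_into J) N J"
    unfolding N_def using assms(1)
    by (intro bij_betwI[where g = "to_nat_on J"]) (auto simp: from_nat_into_to_nat_on)
  then have mem: "from_nat_into J n \<in> J" if "n \<in> N" for n using that by (auto simp: bij_betw_def)
  have A_meas: "A n \<in> sets M" for n using meas mem by (auto simp: A_def)
  have A_disj: "A m \<inter> A n = {}" if "m \<noteq> n" for m n
  proof (cases "m \<in> N \<and> n \<in> N")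
    case True
    then have "from_nat_into J m \<noteq> from_nat_into J n"
      using that bij by (auto simp: bij_betw_def inj_on_def)
    then show ?thesis using True mem disj by (simp add: A_def disjoint_family_on_def)
  qed (auto simp: A_def)
  have "(\<Union>n. A n) = (\<Union>n\<in>N. I (from_nat_into J n))" by (auto simp: A_def split: if_splits)
  also have "\<dots> = (\<Union>i\<in>J. I i)" using bij by (auto simp: bij_betw_def simp flip: UN_simps)
  finally have A_Un: "(\<Union>n. A n) = (\<Union>i\<in>J. I i)" .
  have int_A: "set_integrable M (A n) f" for n
    using int A_Un A_meas by (intro set_integrable_subset[OF int]) auto
  have int_Un: "set_integrable M (\<Union>n. A n) (\<lambda>x. norm (f x))"
    using set_integrable_norm[OF int] by (simp add: A_Un)
  have "summable (\<lambda>n. LINT x:A n|M. norm (f x))"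
  proof (rule summableI_nonneg_bounded)
    fix n
    show "0 \<le> (LINT x:A n|M. norm (f x))"
      unfolding set_lebesgue_integral_def by (intro integral_nonneg_AE) auto
    have "(\<Sum>i<n. LINT x:A i|M. norm (f x)) = (LINT x:(\<Union>i<n. A i)|M. norm (f x))"
      using A_meas A_disj set_integrable_norm[OF int_A]
      by (subst set_integral_finite_Union) (auto simp: disjoint_family_on_def)
    also have "\<dots> \<le> (LINT x:(\<Union>n. A n)|M. norm (f x))"
      unfolding set_lebesgue_integral_def
      using set_integrable_subset[OF int_Un, of "\<Union>i<n. A i"] int_Un A_meas
      by (intro integral_mono) (auto simp: set_integrable_def split: split_indicator)
    finally show "(\<Sum>i<n. LINT x:A i|M. norm (f x)) \<le> (LINT x:(\<Union>n. A n)|M. norm (f x))" .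
  qed
  then have "summable (\<lambda>n. norm (LINT x:A n|M. f x))"
    by (rule summable_comparison_test'[where N = 0]) (use set_integral_norm_bound[OF int_A] in auto)
  moreover from this have "(\<lambda>n. LINT x:A n|M. f x) sums (LINT x:(\<Union>n. A n)|M. f x)"
    using lebesgue_integral_countable_add[of A M f] A_meas A_disj int
    by (simp add: A_Un sums_iff summable_norm_cancel)
  ultimately have "((\<lambda>n. LINT x:A n|M. f x) has_sum (LINT x:(\<Union>n. A n)|M. f x)) UNIV"
    by (rule norm_summable_imp_has_sum)
  also have "?this \<longleftrightarrow>
      ((\<lambda>n. LINT x:I (from_nat_into J n)|M. f x) has_sum (LINT x:(\<Union>n. A n)|M. f x)) N"
    by (rule has_sum_cong_neutral) (auto simp: A_def set_lebesgue_integral_def)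
  also have "\<dots> \<longleftrightarrow> ((\<lambda>i. LINT x:I i|M. f x) has_sum (LINT x:(\<Union>n. A n)|M. f x)) J"
    by (rule has_sum_reindex_bij_betw[OF bij])
  finally show ?thesis by (simp add: A_Un)
qed

section \<open>The regularized equations\<close>

text \<open>\<open>\<tau>\<close> is the supremum of the times with \<open>g s \<le> c\<close>. Past
  it the path stays above the level, where the drift can be estimated; comparison and upper bounds
  both use this device.\<close>

lemma last_crossing:
  fixes g :: "real \<Rightarrow> real"
  assumes "continuous_on {u..t} g" and "u \<le> t" and "g u \<le> c" and "c < g t"
  obtains \<tau> where "u \<le> \<tau>" "\<tau> < t" "g \<tau> = c" "\<And>s. \<tau> < s \<Longrightarrow> s \<le> t \<Longrightarrow> c < g s"
proof -
  define S where "S = {s \<in> {u..t}. g s \<le> c}"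
  have "closed S"
    unfolding S_def by (rule continuous_on_closed_Collect_le) (use assms(1) in auto)
  moreover have "u \<in> S" and bdd: "bdd_above S" using assms by (auto simp: S_def)
  ultimately have SupS: "Sup S \<in> S" by (intro closed_contains_Sup) auto
  have above: "c < g s" if "Sup S < s" "s \<le> t" for s
  proof (rule ccontr)
    assume "\<not> c < g s"
    moreover have "u \<le> s" using SupS that by (auto simp: S_def)
    ultimately have "s \<in> S" using that by (auto simp: S_def)
    then show False using cSup_upper[OF _ bdd, of s] that by auto
  qed
  have "Sup S < t"
    using SupS assms(4) by (cases "Sup S = t") (auto simp: S_def)
  have "g (Sup S) = c"
  proof (rule ccontr)
    assume "g (Sup S) \<noteq> c"
    then have "g (Sup S) \<le> c" using SupS by (auto simp: S_def)
    moreover have "continuous_on {Sup S..t} g"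
      using SupS by (intro continuous_on_subset[OF assms(1)]) (auto simp: S_def)
    ultimately obtain s where "Sup S \<le> s" "s \<le> t" "g s = c"
      using IVT'[of g "Sup S" c t] assms(4) \<open>Sup S < t\<close> by auto
    with above[of s] \<open>g (Sup S) \<noteq> c\<close> show False by (cases "s = Sup S") auto
  qed
  with that[of "Sup S"] above \<open>Sup S < t\<close> SupS show ?thesis by (auto simp: S_def)
qed

lemma set_lebesgue_integral_eq_integral_Icc:
  fixes f :: "real \<Rightarrow> real"
  assumes "continuous_on {u..v} f"
  shows "(LBINT s:{u..v}. f s) = integral {u..v} f"
  using set_borel_integral_eq_integral(2)[OF borel_integrable_atLeastAtMost'[OF assms]] .

lemma integral_Icc_diff:
  fixes f :: "real \<Rightarrow> real"
  assumes "continuous_on {0..} f" and "0 \<le> u" and "u \<le> v"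
  shows "integral {0..v} f - integral {0..u} f = integral {u..v} f"
proof -
  have "f integrable_on {0..v}"
    by (intro integrable_continuous_interval continuous_on_subset[OF assms(1)]) auto
  from Henstock_Kurzweil_Integration.integral_combine[OF assms(2,3) this] show ?thesis by simp
qed

locale regularized_family =
  fixes Y0 k a \<sigma> :: real and b :: "real \<Rightarrow> real" and y :: "real \<Rightarrow> real \<Rightarrow> real"
  assumes Y0_pos: "0 < Y0" and k_pos: "0 < k" and a_pos: "0 < a" and \<sigma>_pos: "0 < \<sigma>"
    and b_0: "b 0 = 0" and cont_b: "continuous_on {0..} b"
    and solution: "0 < \<epsilon> \<Longrightarrow> regularized_solution Y0 k a \<sigma> \<epsilon> b (y \<epsilon>)"
begin

text \<open>The singular part of the drift; \<open>max\<close> replaces the product with the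
  indicator, which makes continuity in \<open>s\<close> evident.\<close>

definition repulsion :: "real \<Rightarrow> real \<Rightarrow> real" where
  "repulsion \<epsilon> s = k / (max (y \<epsilon> s) 0 + \<epsilon>)"

lemma cont_y: "0 < \<epsilon> \<Longrightarrow> continuous_on {0..} (y \<epsilon>)"
  using solution by (auto simp: regularized_solution_def)

lemma cont_repulsion: "0 < \<epsilon> \<Longrightarrow> continuous_on {0..} (repulsion \<epsilon>)"
  unfolding repulsion_def
  by (intro continuous_intros cont_y) (auto simp: add_nonneg_pos less_imp_neq[symmetric])

lemma repulsion_pos: "0 < \<epsilon> \<Longrightarrow> 0 < repulsion \<epsilon> s"
  unfolding repulsion_def using k_pos by (intro divide_pos_pos) auto

lemma integrable_y: "0 < \<epsilon> \<Longrightarrow> 0 \<le> u \<Longrightarrow> y \<epsilon> integrable_on {u..v}"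
  by (intro integrable_continuous_interval continuous_on_subset[OF cont_y]) auto

lemma integrable_repulsion: "0 < \<epsilon> \<Longrightarrow> 0 \<le> u \<Longrightarrow> repulsion \<epsilon> integrable_on {u..v}"
  by (intro integrable_continuous_interval continuous_on_subset[OF cont_repulsion]) auto

lemma y_eq:
  assumes "0 < \<epsilon>" and "0 \<le> t"
  shows "y \<epsilon> t = Y0 + integral {0..t} (repulsion \<epsilon>) / 2 - a / 2 * integral {0..t} (y \<epsilon>)
           + \<sigma> / 2 * b t"
proof -
  have "y s * indicator {0<..} (y s) = max (y s) 0" for y :: "real \<Rightarrow> real" and s
    by (auto simp: indicator_def)
  then have "y \<epsilon> t = Y0 + 1 / 2 * (LBINT s:{0..t}. repulsion \<epsilon> s - a * y \<epsilon> s) + \<sigma> / 2 * b t"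
    using solution[OF assms(1)] assms(2) by (simp add: regularized_solution_def repulsion_def)
  also have "(LBINT s:{0..t}. repulsion \<epsilon> s - a * y \<epsilon> s) =
      integral {0..t} (\<lambda>s. repulsion \<epsilon> s - a * y \<epsilon> s)"
    by (intro set_lebesgue_integral_eq_integral_Icc continuous_intros
        continuous_on_subset[OF cont_repulsion] continuous_on_subset[OF cont_y]) (use assms in auto)
  also have "\<dots> = integral {0..t} (repulsion \<epsilon>) - a * integral {0..t} (y \<epsilon>)"
    using integral_diff[OF integrable_repulsion[OF assms(1), of 0 t]
        integrable_on_mult_right[OF integrable_y[OF assms(1), of 0 t]], of a] by simp
  finally show ?thesis by (simp add: field_simps)
qed

lemma y_0: "0 < \<epsilon> \<Longrightarrow> y \<epsilon> 0 = Y0"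
  using y_eq[of \<epsilon> 0] b_0 by simp

lemma y_increment:
  assumes "0 < \<epsilon>" and "0 \<le> u" and "u \<le> v"
  shows "y \<epsilon> v - y \<epsilon> u = integral {u..v} (repulsion \<epsilon>) / 2 - a / 2 * integral {u..v} (y \<epsilon>)
           + \<sigma> / 2 * (b v - b u)"
  using y_eq[of \<epsilon> u] y_eq[of \<epsilon> v] integral_Icc_diff[OF cont_y assms(2,3), of \<epsilon>]
    integral_Icc_diff[OF cont_repulsion assms(2,3), of \<epsilon>] assms
  by (simp add: algebra_simps flip: diff_divide_distrib)
    (simp add: field_simps)

section \<open>Comparison in \<epsilon> and bounds independent of it\<close>

text \<open>Suppose the path for the larger \<epsilon> ends up above. Past the last time the two
  paths agree it has the weaker repulsion and the stronger damping, and the noise is the same, so it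
  cannot have gained on the other.\<close>

lemma y_antimono:
  assumes "0 < \<epsilon>'" and "\<epsilon>' \<le> \<epsilon>" and "0 \<le> t"
  shows "y \<epsilon> t \<le> y \<epsilon>' t"
proof (rule ccontr)
  assume less: "\<not> y \<epsilon> t \<le> y \<epsilon>' t"
  have \<epsilon>: "0 < \<epsilon>" using assms by simp
  have "continuous_on {0..t} (\<lambda>s. y \<epsilon> s - y \<epsilon>' s)"
    by (intro continuous_intros continuous_on_subset[OF cont_y] \<epsilon> assms) auto
  then obtain \<tau> where \<tau>: "0 \<le> \<tau>" "\<tau> < t" "y \<epsilon> \<tau> - y \<epsilon>' \<tau> = 0"
    and above: "\<And>s. \<tau> < s \<Longrightarrow> s \<le> t \<Longrightarrow> 0 < y \<epsilon> s - y \<epsilon>' s"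
    using less last_crossing[of 0 t "\<lambda>s. y \<epsilon> s - y \<epsilon>' s" 0] assms \<epsilon>
    by (auto simp: y_0)
  have le: "y \<epsilon>' s \<le> y \<epsilon> s" if "s \<in> {\<tau>..t}" for s
    using above[of s] \<tau>(3) that by (cases "s = \<tau>") auto
  have "integral {\<tau>..t} (repulsion \<epsilon>) \<le> integral {\<tau>..t} (repulsion \<epsilon>')"
  proof (rule integral_le)
    fix s assume "s \<in> {\<tau>..t}"
    then show "repulsion \<epsilon> s \<le> repulsion \<epsilon>' s"
      using le[of s] assms k_pos unfolding repulsion_def
      by (intro divide_left_mono mult_pos_pos) auto
  qed (use \<epsilon> assms \<tau> integrable_repulsion in auto)
  moreover have "integral {\<tau>..t} (y \<epsilon>') \<le> integral {\<tau>..t} (y \<epsilon>)"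
    by (rule integral_le) (use \<epsilon> assms \<tau> integrable_y le in auto)
  then have "a / 2 * integral {\<tau>..t} (y \<epsilon>') \<le> a / 2 * integral {\<tau>..t} (y \<epsilon>)"
    using a_pos by (intro mult_left_mono) auto
  ultimately show False
    using y_increment[OF \<epsilon> \<tau>(1), of t] y_increment[OF assms(1) \<tau>(1), of t] above[of t] \<tau> by simp
qed

text \<open>Past the last visit to the level \<open>max (y \<epsilon> u) \<delta>\<close> the
  repulsion is at most \<open>k / \<delta>\<close> and the damping points down. As the time of that
  visit is unknown, \<open>r\<close> has to dominate the noise increment from every starting
  time.\<close>

lemma y_upper:
  assumes "0 < \<epsilon>" and "0 < \<delta>" and "0 \<le> u" and "u \<le> v"
    and r: "\<And>\<tau>. \<tau> \<in> {u..v} \<Longrightarrow> \<sigma> / 2 * (b v - b \<tau>) \<le> r"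
  shows "y \<epsilon> v \<le> max (y \<epsilon> u) \<delta> + k / (2 * \<delta>) * (v - u) + r"
proof (rule ccontr)
  assume less: "\<not> ?thesis"
  have "0 \<le> r" using r[of v] assms by simp
  moreover have "0 \<le> k / (2 * \<delta>) * (v - u)" using assms k_pos by auto
  ultimately have "max (y \<epsilon> u) \<delta> < y \<epsilon> v" using less by linarith
  moreover have "continuous_on {u..v} (y \<epsilon>)"
    by (intro continuous_on_subset[OF cont_y] assms) (use assms in auto)
  ultimately obtain \<tau> where \<tau>: "u \<le> \<tau>" "\<tau> < v" "y \<epsilon> \<tau> = max (y \<epsilon> u) \<delta>"
    and above: "\<And>s. \<tau> < s \<Longrightarrow> s \<le> v \<Longrightarrow> max (y \<epsilon> u) \<delta> < y \<epsilon> s"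
    using last_crossing[of u v "y \<epsilon>" "max (y \<epsilon> u) \<delta>"] assms by (metis max.cobounded1)
  have ge: "\<delta> \<le> y \<epsilon> s" if "s \<in> {\<tau>..v}" for s
    using above[of s] \<tau>(3) that by (cases "s = \<tau>") auto
  have "integral {\<tau>..v} (repulsion \<epsilon>) \<le> integral {\<tau>..v} (\<lambda>_. k / \<delta>)"
  proof (rule integral_le)
    fix s assume "s \<in> {\<tau>..v}"
    then show "repulsion \<epsilon> s \<le> k / \<delta>"
      using ge[of s] assms k_pos unfolding repulsion_def
      by (intro divide_left_mono mult_pos_pos) auto
  qed (use assms \<tau> integrable_repulsion in auto)
  also have "\<dots> = k / \<delta> * (v - \<tau>)" using \<tau> by simp
  also have "\<dots> \<le> k / \<delta> * (v - u)" using \<tau> assms k_pos by (intro mult_left_mono) auto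
  finally have "integral {\<tau>..v} (repulsion \<epsilon>) / 2 \<le> k / (2 * \<delta>) * (v - u)" by simp
  moreover have "0 \<le> integral {\<tau>..v} (y \<epsilon>)"
  proof (rule integral_nonneg)
    fix s assume "s \<in> {\<tau>..v}"
    then show "0 \<le> y \<epsilon> s" using ge[of s] assms(2) by linarith
  qed (use assms \<tau> integrable_y in auto)
  then have "0 \<le> a / 2 * integral {\<tau>..v} (y \<epsilon>)" using a_pos by simp
  ultimately show False
    using y_increment[OF assms(1), of \<tau> v] r[of \<tau>] \<tau> assms less by simp
qed

text \<open>The repulsion only pushes upwards, so a fall comes from the noise and from the damping,
  which \<open>K\<close> controls.\<close>

lemma y_lower:
  assumes "0 < \<epsilon>" and "0 \<le> u" and "u \<le> v"
    and K: "\<And>s. s \<in> {u..v} \<Longrightarrow> y \<epsilon> s \<le> K"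
  shows "y \<epsilon> u - a / 2 * K * (v - u) + \<sigma> / 2 * (b v - b u) \<le> y \<epsilon> v"
proof -
  have "integral {u..v} (y \<epsilon>) \<le> integral {u..v} (\<lambda>_. K)"
    by (rule integral_le) (use assms integrable_y in auto)
  then have "a / 2 * integral {u..v} (y \<epsilon>) \<le> a / 2 * (K * (v - u))"
    using a_pos assms by (intro mult_left_mono) (auto simp: mult.commute)
  moreover have "0 \<le> integral {u..v} (repulsion \<epsilon>)"
    by (rule integral_nonneg) (use assms integrable_repulsion less_imp_le[OF repulsion_pos] in auto)
  ultimately show ?thesis using y_increment[OF assms(1-3)] by simp
qed

end

section \<open>The limit path\<close>

text \<open>\<open>Lim\<close> denotes some value even where no limit exists; actual convergence is
  proved in \<open>Y_tendsto\<close>.\<close>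

locale regularized_limit = regularized_family +
  fixes Y :: "real \<Rightarrow> real"
  assumes Y_eq_Lim: "0 \<le> t \<Longrightarrow> Y t = Lim (at_right 0) (\<lambda>\<epsilon>. y \<epsilon> t)"
begin

section \<open>Bounds and one-sided moduli uniform in \<epsilon>\<close>

lemma b_uniform:
  assumes "0 < e"
  obtains \<eta> where "0 < \<eta>"
    "\<And>u v. 0 \<le> u \<Longrightarrow> u \<le> v \<Longrightarrow> v \<le> T \<Longrightarrow> v - u < \<eta> \<Longrightarrow> \<sigma> / 2 * \<bar>b v - b u\<bar> \<le> e"
proof -
  have "uniformly_continuous_on {0..T} (\<lambda>t. \<sigma> / 2 * b t)"
    by (intro compact_uniformly_continuous continuous_intros continuous_on_subset[OF cont_b]) auto
  then obtain \<eta> where "0 < \<eta>" and \<eta>: "\<And>u v. u \<in> {0..T} \<Longrightarrow> v \<in> {0..T} \<Longrightarrow> dist v u < \<eta> \<Longrightarrow>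
      dist (\<sigma> / 2 * b v) (\<sigma> / 2 * b u) < e"
    using assms unfolding uniformly_continuous_on_def by metis
  have "\<sigma> / 2 * \<bar>b v - b u\<bar> = dist (\<sigma> / 2 * b v) (\<sigma> / 2 * b u)" for u v
    using \<sigma>_pos by (simp add: dist_real_def abs_mult flip: right_diff_distrib diff_divide_distrib)
  then have "\<sigma> / 2 * \<bar>b v - b u\<bar> \<le> e" if "0 \<le> u" "u \<le> v" "v \<le> T" "v - u < \<eta>" for u v
    using that \<eta>[of u v] by (simp add: dist_real_def[of v u])
  with \<open>0 < \<eta>\<close> that show thesis by blast
qed

text \<open>This is \<open>y_upper\<close> from time 0 with level 1; the noise increments are at
  most \<open>\<sigma> * c\<close> because \<open>c\<close> bounds the absolute value of
  \<open>b\<close>.\<close>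

lemma y_bounded:
  obtains K where "0 < K" "\<And>\<epsilon> t. 0 < \<epsilon> \<Longrightarrow> 0 \<le> t \<Longrightarrow> t \<le> T \<Longrightarrow> y \<epsilon> t \<le> K"
proof -
  have "bounded (b ` {0..T})"
    by (intro compact_imp_bounded compact_continuous_image continuous_on_subset[OF cont_b]) auto
  then obtain c where c: "0 < c" "\<And>t. t \<in> {0..T} \<Longrightarrow> \<bar>b t\<bar> \<le> c"
    unfolding bounded_pos by auto
  have "y \<epsilon> t \<le> max Y0 1 + k / 2 * \<bar>T\<bar> + \<sigma> * c" if "0 < \<epsilon>" "0 \<le> t" "t \<le> T" for \<epsilon> t
  proof -
    have "\<sigma> / 2 * (b t - b \<tau>) \<le> \<sigma> * c" if "\<tau> \<in> {0..t}" for \<tau>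
    proof -
      have "b t - b \<tau> \<le> 2 * c" using c(2)[of t] c(2)[of \<tau>] that \<open>0 \<le> t\<close> \<open>t \<le> T\<close> by auto
      then have "\<sigma> / 2 * (b t - b \<tau>) \<le> \<sigma> / 2 * (2 * c)" using \<sigma>_pos by (intro mult_left_mono) auto
      then show ?thesis by simp
    qed
    then have "y \<epsilon> t \<le> max (y \<epsilon> 0) 1 + k / (2 * 1) * (t - 0) + \<sigma> * c"
      using that by (intro y_upper) auto
    moreover have "k / 2 * t \<le> k / 2 * \<bar>T\<bar>" using that k_pos by (intro mult_left_mono) auto
    ultimately show ?thesis using y_0[OF that(1)] by simp
  qed
  moreover have "0 < max Y0 1 + k / 2 * \<bar>T\<bar> + \<sigma> * c"
    using k_pos \<sigma>_pos c(1) by (intro add_pos_pos add_pos_nonneg) auto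
  ultimately show thesis using that by metis
qed

text \<open>By \<open>y_antimono\<close> and \<open>y_bounded\<close> the values increase to a
  finite supremum as \<epsilon> decreases.\<close>

lemma Y_tendsto:
  assumes "0 \<le> t"
  shows "((\<lambda>\<epsilon>. y \<epsilon> t) \<longlongrightarrow> Y t) (at_right 0)" and "0 < \<epsilon> \<Longrightarrow> y \<epsilon> t \<le> Y t"
proof -
  define L where "L = (SUP \<epsilon>\<in>{0<..}. y \<epsilon> t)"
  obtain K where "\<And>\<epsilon> s. 0 < \<epsilon> \<Longrightarrow> 0 \<le> s \<Longrightarrow> s \<le> t \<Longrightarrow> y \<epsilon> s \<le> K"
    using y_bounded[of t] by metis
  then have bdd: "bdd_above ((\<lambda>\<epsilon>. y \<epsilon> t) ` {0<..})"
    using assms by (intro bdd_aboveI[of _ K]) auto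
  have upper: "y \<epsilon> t \<le> L" if "0 < \<epsilon>" for \<epsilon>
    unfolding L_def using that by (intro cSUP_upper bdd) auto
  have "((\<lambda>\<epsilon>. y \<epsilon> t) \<longlongrightarrow> L) (at_right 0)"
  proof (rule increasing_tendsto)
    show "\<forall>\<^sub>F \<epsilon> in at_right 0. y \<epsilon> t \<le> L"
      using upper by (intro eventually_at_right_less[THEN eventually_mono]) auto
    fix x assume "x < L"
    then obtain \<epsilon>' where \<epsilon>': "0 < \<epsilon>'" "x < y \<epsilon>' t"
      unfolding L_def by (subst (asm) less_cSUP_iff[OF _ bdd]) auto
    have "x < y \<epsilon> t" if "\<epsilon> \<in> {0<..<\<epsilon>'}" for \<epsilon>
      using y_antimono[of \<epsilon> \<epsilon>' t] that assms \<epsilon>'(2) by auto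
    then show "\<forall>\<^sub>F \<epsilon> in at_right 0. x < y \<epsilon> t"
      using eventually_at_right_real[OF \<epsilon>'(1)] by (auto elim: eventually_mono)
  qed
  moreover from this have "Y t = L"
    using Y_eq_Lim[OF assms] by (simp add: tendsto_Lim)
  ultimately show "((\<lambda>\<epsilon>. y \<epsilon> t) \<longlongrightarrow> Y t) (at_right 0)" and "0 < \<epsilon> \<Longrightarrow> y \<epsilon> t \<le> Y t"
    using upper by auto
qed

lemma Y_0: "Y 0 = Y0"
proof -
  have "((\<lambda>\<epsilon>. y \<epsilon> 0) \<longlongrightarrow> Y0) (at_right 0)"
    using y_0 by (intro tendsto_eventually eventually_at_right_less[THEN eventually_mono]) auto
  then show ?thesis using Y_tendsto(1)[of 0] tendsto_unique[of "at_right (0::real)"] by auto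
qed

text \<open>The error terms of \<open>y_lower\<close> do not involve \<epsilon>, so one
  \<open>\<eta>\<close> serves all \<epsilon>.\<close>

lemma y_drop_small:
  assumes "0 < e"
  obtains \<eta> where "0 < \<eta>"
    "\<And>\<epsilon> u v. 0 < \<epsilon> \<Longrightarrow> 0 \<le> u \<Longrightarrow> u \<le> v \<Longrightarrow> v \<le> T \<Longrightarrow> v - u < \<eta> \<Longrightarrow> y \<epsilon> u - e \<le> y \<epsilon> v"
proof -
  obtain K where K: "0 < K" "\<And>\<epsilon> t. 0 < \<epsilon> \<Longrightarrow> 0 \<le> t \<Longrightarrow> t \<le> T \<Longrightarrow> y \<epsilon> t \<le> K"
    using y_bounded[of T] by metis
  obtain \<eta> where \<eta>: "0 < \<eta>"
    "\<And>u v. 0 \<le> u \<Longrightarrow> u \<le> v \<Longrightarrow> v \<le> T \<Longrightarrow> v - u < \<eta> \<Longrightarrow> \<sigma> / 2 * \<bar>b v - b u\<bar> \<le> e / 2"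
    using b_uniform[of "e / 2"] assms by auto
  show thesis
  proof (rule that)
    \<comment> \<open>On lengths below \<open>e / (a * K)\<close> the damping costs at most
      \<open>e / 2\<close>; on lengths below \<open>\<eta>\<close> so does the noise.\<close>
    show "0 < min \<eta> (e / (a * K))" using \<eta>(1) assms a_pos K(1) by simp
    fix \<epsilon> u v :: real assume *: "0 < \<epsilon>" "0 \<le> u" "u \<le> v" "v \<le> T" "v - u < min \<eta> (e / (a * K))"
    have "y \<epsilon> u - a / 2 * K * (v - u) + \<sigma> / 2 * (b v - b u) \<le> y \<epsilon> v"
      using * K(2) by (intro y_lower) auto
    moreover have "a / 2 * K * (v - u) \<le> e / 2"
      using * a_pos K(1) by (simp add: pos_less_divide_eq mult.commute)
    moreover have "\<sigma> / 2 * (b u - b v) \<le> \<sigma> / 2 * \<bar>b v - b u\<bar>"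
      using \<sigma>_pos by (intro mult_left_mono) auto
    then have "\<sigma> / 2 * (b u - b v) \<le> e / 2" using \<eta>(2)[of u v] * by simp
    then have "- (e / 2) \<le> \<sigma> / 2 * (b v - b u)" by (simp add: right_diff_distrib)
    ultimately show "y \<epsilon> u - e \<le> y \<epsilon> v" by linarith
  qed
qed

text \<open>Near zero the repulsion is not bounded uniformly in \<epsilon>, but above the level
  \<open>e\<close> it is at most \<open>k / e\<close>; hence the \<open>max\<close>.\<close>

lemma y_rise_small:
  assumes "0 < e"
  obtains \<eta> where "0 < \<eta>"
    "\<And>\<epsilon> u v. 0 < \<epsilon> \<Longrightarrow> 0 \<le> u \<Longrightarrow> u \<le> v \<Longrightarrow> v \<le> T \<Longrightarrow> v - u < \<eta> \<Longrightarrow> y \<epsilon> v \<le> max (y \<epsilon> u) e + e"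
proof -
  obtain \<eta> where \<eta>: "0 < \<eta>"
    "\<And>u v. 0 \<le> u \<Longrightarrow> u \<le> v \<Longrightarrow> v \<le> T \<Longrightarrow> v - u < \<eta> \<Longrightarrow> \<sigma> / 2 * \<bar>b v - b u\<bar> \<le> e / 2"
    using b_uniform[of "e / 2"] assms by auto
  show thesis
  proof (rule that)
    \<comment> \<open>The length \<open>e * e / k\<close> makes the drift term
      \<open>k / (2 * e) * (v - u)\<close> at most \<open>e / 2\<close>.\<close>
    show "0 < min \<eta> (e * e / k)" using \<eta>(1) assms k_pos by simp
    fix \<epsilon> u v :: real assume *: "0 < \<epsilon>" "0 \<le> u" "u \<le> v" "v \<le> T" "v - u < min \<eta> (e * e / k)"
    have "\<sigma> / 2 * (b v - b \<tau>) \<le> e / 2" if "\<tau> \<in> {u..v}" for \<tau>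
    proof -
      have "\<sigma> / 2 * (b v - b \<tau>) \<le> \<sigma> / 2 * \<bar>b v - b \<tau>\<bar>"
        using \<sigma>_pos by (intro mult_left_mono) auto
      then show ?thesis using \<eta>(2)[of \<tau> v] * that by auto
    qed
    then have "y \<epsilon> v \<le> max (y \<epsilon> u) e + k / (2 * e) * (v - u) + e / 2"
      using * assms by (intro y_upper) auto
    moreover have "k / (2 * e) * (v - u) \<le> e / 2"
      using * assms k_pos by (simp add: field_simps)
    ultimately show "y \<epsilon> v \<le> max (y \<epsilon> u) e + e" by linarith
  qed
qed

section \<open>Nonnegativity, continuity and zero set of the limit\<close>

text \<open>Solving the equation for this integral leaves only terms bounded above uniformly in
  \<epsilon>.\<close>

lemma integral_repulsion_bounded:
  assumes "0 \<le> T"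
  obtains C where "0 < C" "\<And>\<epsilon>. 0 < \<epsilon> \<Longrightarrow> integral {0..T} (repulsion \<epsilon>) \<le> C"
proof -
  obtain K where K: "0 < K" "\<And>\<epsilon> t. 0 < \<epsilon> \<Longrightarrow> 0 \<le> t \<Longrightarrow> t \<le> T \<Longrightarrow> y \<epsilon> t \<le> K"
    using y_bounded[of T] by metis
  have "integral {0..T} (repulsion \<epsilon>) \<le> 2 * K + a * (K * T) + \<sigma> * \<bar>b T\<bar>" if "0 < \<epsilon>" for \<epsilon>
  proof -
    have "integral {0..T} (y \<epsilon>) \<le> integral {0..T} (\<lambda>_. K)"
      by (rule integral_le) (use K that integrable_y in auto)
    then have "a * integral {0..T} (y \<epsilon>) \<le> a * (K * T)"
      using a_pos assms by (intro mult_left_mono) (auto simp: mult.commute)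
    moreover have "\<sigma> * (- b T) \<le> \<sigma> * \<bar>b T\<bar>" using \<sigma>_pos by (intro mult_left_mono) auto
    moreover have "y \<epsilon> T \<le> K" using K that assms by auto
    ultimately show ?thesis using y_eq[OF that assms] Y0_pos by (simp add: field_simps)
  qed
  moreover have "0 < 2 * K + a * (K * T) + \<sigma> * \<bar>b T\<bar>"
    using K a_pos \<sigma>_pos assms by (intro add_pos_nonneg) auto
  ultimately show thesis using that by metis
qed

text \<open>If \<open>Y t < 0\<close>, the uniform drop estimate keeps \<open>y \<epsilon>\<close>
  nonpositive on a window before \<open>t\<close> whose length \<open>h\<close> does not depend on
  \<epsilon>. There the repulsion equals \<open>k / \<epsilon>\<close>, which contradicts the bound
  on its integral for small \<epsilon>.\<close>

lemma Y_nonneg: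
  assumes "0 \<le> t"
  shows "0 \<le> Y t"
proof (rule ccontr)
  assume neg: "\<not> 0 \<le> Y t"
  then have "0 < t" using Y_0 Y0_pos assms by (cases "t = 0") auto
  obtain \<eta> where \<eta>: "0 < \<eta>" "\<And>\<epsilon> u v. 0 < \<epsilon> \<Longrightarrow> 0 \<le> u \<Longrightarrow> u \<le> v \<Longrightarrow> v \<le> t \<Longrightarrow> v - u < \<eta> \<Longrightarrow>
      y \<epsilon> u - (- Y t) \<le> y \<epsilon> v"
    using y_drop_small[of "- Y t"] neg by (auto simp del: diff_minus_eq_add)
  define h where "h = min (\<eta> / 2) t"
  have h: "0 < h" "h \<le> t" "h < \<eta>" using \<eta>(1) \<open>0 < t\<close> by (auto simp: h_def)
  obtain C where C: "0 < C" "\<And>\<epsilon>. 0 < \<epsilon> \<Longrightarrow> integral {0..t} (repulsion \<epsilon>) \<le> C"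
    using integral_repulsion_bounded[OF assms] by metis
  have le: "k * h / \<epsilon> \<le> C" if "0 < \<epsilon>" for \<epsilon>
  proof -
    have "integral {t - h..t} (\<lambda>_. k / \<epsilon>) \<le> integral {t - h..t} (repulsion \<epsilon>)"
    proof (rule integral_le)
      fix s assume "s \<in> {t - h..t}"
      then have "y \<epsilon> s \<le> 0" using \<eta>(2)[of \<epsilon> s t] Y_tendsto(2)[of t \<epsilon>] h that assms by auto
      then show "k / \<epsilon> \<le> repulsion \<epsilon> s" by (simp add: repulsion_def)
    qed (use that h integrable_repulsion in auto)
    also have "\<dots> \<le> integral {0..t} (repulsion \<epsilon>)"
      using that h integrable_repulsion less_imp_le[OF repulsion_pos]
      by (intro integral_subset_le) auto
    finally show ?thesis using C(2)[OF that] h by (simp add: mult.commute)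
  qed
  \<comment> \<open>This choice of \<epsilon> turns the bound into
    \<open>2 * C \<le> C\<close>.\<close>
  have "k * h / (k * h / (2 * C)) \<le> C" using k_pos h C(1) by (intro le) auto
  then show False using k_pos h C(1) by (simp add: field_simps)
qed

text \<open>Both one-sided estimates are uniform in \<epsilon> and survive the limit. Since
  \<open>Y\<close> is nonnegative, the bound \<open>max (Y u) (e / 2) + e / 2\<close> is at most
  \<open>Y u + e\<close>.\<close>

lemma Y_uniform:
  assumes "0 < e"
  obtains \<eta> where "0 < \<eta>"
    "\<And>u v. 0 \<le> u \<Longrightarrow> u \<le> v \<Longrightarrow> v \<le> T \<Longrightarrow> v - u < \<eta> \<Longrightarrow> \<bar>Y v - Y u\<bar> \<le> e"
proof -
  obtain \<eta>1 where \<eta>1: "0 < \<eta>1"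
    "\<And>\<epsilon> u v. 0 < \<epsilon> \<Longrightarrow> 0 \<le> u \<Longrightarrow> u \<le> v \<Longrightarrow> v \<le> T \<Longrightarrow> v - u < \<eta>1 \<Longrightarrow> y \<epsilon> u - e \<le> y \<epsilon> v"
    using y_drop_small[OF assms, of T] by metis
  obtain \<eta>2 where \<eta>2: "0 < \<eta>2"
    "\<And>\<epsilon> u v. 0 < \<epsilon> \<Longrightarrow> 0 \<le> u \<Longrightarrow> u \<le> v \<Longrightarrow> v \<le> T \<Longrightarrow> v - u < \<eta>2 \<Longrightarrow>
      y \<epsilon> v \<le> max (y \<epsilon> u) (e / 2) + e / 2"
    using y_rise_small[of "e / 2"] assms by (metis half_gt_zero)
  show thesis
  proof (rule that)
    show "0 < min \<eta>1 \<eta>2" using \<eta>1 \<eta>2 by simp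
    fix u v assume *: "0 \<le> u" "u \<le> v" "v \<le> T" "v - u < min \<eta>1 \<eta>2"
    have pos: "\<forall>\<^sub>F \<epsilon> in at_right 0. (0::real) < \<epsilon>" by (rule eventually_at_right_less)
    have "Y u - e \<le> Y v"
      by (rule tendsto_le[OF trivial_limit_at_right_real Y_tendsto(1)
            tendsto_diff[OF Y_tendsto(1) tendsto_const]])
        (use * \<eta>1 pos in \<open>auto elim: eventually_mono\<close>)
    moreover have "Y v \<le> max (Y u) (e / 2) + e / 2"
      by (rule tendsto_le[OF trivial_limit_at_right_real
            tendsto_add[OF tendsto_max[OF Y_tendsto(1) tendsto_const] tendsto_const] Y_tendsto(1)])
        (use * \<eta>2 pos in \<open>auto elim: eventually_mono\<close>)
    ultimately show "\<bar>Y v - Y u\<bar> \<le> e" using Y_nonneg[of u] assms * by (auto simp: max_def split: if_splits)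
  qed
qed

lemma cont_Y: "continuous_on {0..} Y"
proof (clarsimp simp: continuous_on_iff)
  fix t e :: real assume "0 \<le> t" "0 < e"
  then obtain \<eta> where \<eta>: "0 < \<eta>"
    "\<And>u v. 0 \<le> u \<Longrightarrow> u \<le> v \<Longrightarrow> v \<le> t + 1 \<Longrightarrow> v - u < \<eta> \<Longrightarrow> \<bar>Y v - Y u\<bar> \<le> e / 2"
    using Y_uniform[of "e / 2"] by (metis half_gt_zero)
  have "\<bar>Y s - Y t\<bar> < e" if "0 \<le> s" "\<bar>s - t\<bar> < min \<eta> 1" for s
    using \<eta>(2)[of s t] \<eta>(2)[of t s] that \<open>0 \<le> t\<close> \<open>0 < e\<close>
    by (cases "s \<le> t") (auto simp: abs_minus_commute)
  then show "\<exists>d>0. \<forall>x'\<in>{0..}. dist x' t < d \<longrightarrow> dist (Y x') (Y t) < e"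
    using \<eta>(1) by (intro exI[of _ "min \<eta> 1"]) (auto simp: dist_real_def)
qed

text \<open>On the zero set \<open>y \<epsilon> \<le> Y = 0\<close>, so the repulsion there is
  exactly \<open>k / \<epsilon>\<close>; positive measure would violate the uniform bound on its
  integral.\<close>

lemma negligible_zeros: "negligible {s \<in> {0..T}. Y s = 0}"
proof (cases "0 \<le> T")
  case True
  define Z where "Z = {s \<in> {0..T}. Y s = 0}"
  have "closed Z" unfolding Z_def
    by (intro continuous_closed_preimage_constant continuous_on_subset[OF cont_Y]) auto
  moreover have "bounded Z" unfolding Z_def by (rule bounded_subset[of "{0..T}"]) auto
  ultimately have Z: "Z \<in> lmeasurable" by (intro lmeasurable_compact) (simp add: compact_eq_bounded_closed)
  obtain C where C: "0 < C" "\<And>\<epsilon>. 0 < \<epsilon> \<Longrightarrow> integral {0..T} (repulsion \<epsilon>) \<le> C"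
    using integral_repulsion_bounded[OF True] by metis
  have le: "k / \<epsilon> * measure lebesgue Z \<le> C" if "0 < \<epsilon>" for \<epsilon>
  proof -
    have "((\<lambda>_. k / \<epsilon>) has_integral (k / \<epsilon> * measure lebesgue Z)) Z"
      using lmeasure_integral[OF Z] integrable_integral[OF Z[unfolded lmeasurable_iff_integrable_on]]
        has_integral_mult_right[of "\<lambda>_. 1" "measure lebesgue Z" Z "k / \<epsilon>"] by auto
    then have "((\<lambda>s. if s \<in> Z then k / \<epsilon> else 0) has_integral (k / \<epsilon> * measure lebesgue Z)) {0..T}"
      by (subst has_integral_restrict) (auto simp: Z_def)
    moreover have "(repulsion \<epsilon> has_integral integral {0..T} (repulsion \<epsilon>)) {0..T}"
      using that by (intro integrable_integral integrable_repulsion) auto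
    ultimately have "k / \<epsilon> * measure lebesgue Z \<le> integral {0..T} (repulsion \<epsilon>)"
    proof (rule has_integral_le)
      fix s assume "s \<in> {0..T}"
      then show "(if s \<in> Z then k / \<epsilon> else 0) \<le> repulsion \<epsilon> s"
        using Y_tendsto(2)[of s \<epsilon>] that less_imp_le[OF repulsion_pos[OF that]]
        by (auto simp: Z_def repulsion_def)
    qed
    then show ?thesis using C(2)[OF that] by simp
  qed
  have "measure lebesgue Z = 0"
  proof (rule ccontr)
    assume "measure lebesgue Z \<noteq> 0"
    then have m: "0 < measure lebesgue Z" by (simp add: zero_less_measure_iff)
    \<comment> \<open>Again the chosen \<epsilon> would give \<open>2 * C \<le> C\<close>.\<close>
    then have "k / (k * measure lebesgue Z / (2 * C)) * measure lebesgue Z \<le> C"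
      using k_pos C by (intro le) auto
    then show False using k_pos m C(1) by (simp add: field_simps)
  qed
  then have "negligible Z" using Z by (simp add: negligible_iff_measure)
  then show ?thesis by (simp add: Z_def)
qed auto

section \<open>The limiting repulsion integral\<close>

lemma integrable_Y: "0 \<le> u \<Longrightarrow> Y integrable_on {u..v}"
  by (intro integrable_continuous_interval continuous_on_subset[OF cont_Y]) auto

text \<open>Stands for \<open>\<integral> k / (2Y)\<close>; reading it off the limit equation avoids the passage to the limit
  in \<open>1 / y \<epsilon>\<close>.\<close>

definition G :: "real \<Rightarrow> real" where
  "G t = Y t - Y0 + a / 2 * integral {0..t} Y - \<sigma> / 2 * b t"

text \<open>Dominated convergence works along a sequence; as its terms are at most 1,
  \<open>y 1\<close> is a common lower bound.\<close>

abbreviation eps :: "nat \<Rightarrow> real" where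
  "eps n \<equiv> inverse (real (Suc n))"

lemma y_eps_tendsto: "0 \<le> t \<Longrightarrow> (\<lambda>n. y (eps n) t) \<longlonglongrightarrow> Y t"
  by (rule filterlim_compose[OF Y_tendsto(1)])
    (auto simp: filterlim_at LIMSEQ_inverse_real_of_nat simp del: of_nat_Suc)

lemma integral_y_tendsto:
  assumes "0 \<le> t"
  shows "(\<lambda>n. integral {0..t} (y (eps n))) \<longlonglongrightarrow> integral {0..t} Y"
proof (rule dominated_convergence(2))
  show "y (eps n) integrable_on {0..t}" for n by (intro integrable_y) auto
  show "(\<lambda>s. \<bar>y 1 s\<bar> + Y s) integrable_on {0..t}"
    by (intro integrable_continuous_interval continuous_intros
        continuous_on_subset[OF cont_Y] continuous_on_subset[OF cont_y]) auto
  show "norm (y (eps n) s) \<le> \<bar>y 1 s\<bar> + Y s" if "s \<in> {0..t}" for n s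
  proof -
    have "y 1 s \<le> y (eps n) s"
      using that by (intro y_antimono) (auto simp: inverse_le_1_iff simp del: of_nat_Suc)
    moreover have "y (eps n) s \<le> Y s" using that by (intro Y_tendsto) auto
    ultimately show ?thesis using Y_nonneg[of s] that by auto
  qed
  show "(\<lambda>n. y (eps n) s) \<longlonglongrightarrow> Y s" if "s \<in> {0..t}" for s
    using that by (intro y_eps_tendsto) auto
qed

lemma G_increment:
  assumes "0 \<le> u" and "u \<le> v"
  shows "G v - G u = Y v - Y u + a / 2 * integral {u..v} Y - \<sigma> / 2 * (b v - b u)"
  unfolding G_def integral_Icc_diff[OF cont_Y assms, symmetric] by (simp add: field_simps)

text \<open>In the increment form of the equation the path and the damping integral converge and the
  noise is fixed, so the repulsion integral has to converge as well.\<close>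

lemma integral_repulsion_tendsto:
  assumes "0 \<le> u" and "u \<le> v"
  shows "(\<lambda>n. integral {u..v} (repulsion (eps n)) / 2) \<longlonglongrightarrow> G v - G u"
proof -
  have *: "(\<lambda>n. y (eps n) t - Y0 + a / 2 * integral {0..t} (y (eps n)) - \<sigma> / 2 * b t) \<longlonglongrightarrow> G t"
    if "0 \<le> t" for t
    unfolding G_def by (intro tendsto_intros y_eps_tendsto integral_y_tendsto that)
  have eq: "integral {u..v} (repulsion (eps n)) / 2 =
      (y (eps n) v - Y0 + a / 2 * integral {0..v} (y (eps n)) - \<sigma> / 2 * b v) -
      (y (eps n) u - Y0 + a / 2 * integral {0..u} (y (eps n)) - \<sigma> / 2 * b u)" for n
  proof -
    have "integral {u..v} (repulsion (eps n)) / 2 =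
        y (eps n) v - y (eps n) u + a / 2 * integral {u..v} (y (eps n)) - \<sigma> / 2 * (b v - b u)"
      using y_increment[of "eps n" u v] assms by (simp del: of_nat_Suc)
    also have "integral {u..v} (y (eps n)) = integral {0..v} (y (eps n)) - integral {0..u} (y (eps n))"
      by (rule integral_Icc_diff[OF cont_y assms, symmetric]) simp
    finally show ?thesis by (simp add: field_simps del: of_nat_Suc)
  qed
  show ?thesis unfolding eq by (intro tendsto_diff *) (use assms in auto)
qed

lemma G_mono:
  assumes "0 \<le> u" and "u \<le> v"
  shows "G u \<le> G v"
proof -
  have "0 \<le> integral {u..v} (repulsion (eps n)) / 2" for n
    using assms less_imp_le[OF repulsion_pos[of "eps n"]]
    by (auto intro!: integral_nonneg integrable_repulsion simp del: of_nat_Suc)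
  then show ?thesis
    using tendsto_lowerbound[OF integral_repulsion_tendsto[OF assms], of 0] by simp
qed

text \<open>Incremental form of \<open>Y dG = (k / 2) dt\<close>. The repulsion times its own
  denominator is exactly \<open>k\<close>, and on a short interval that denominator is squeezed
  between endpoint values up to small errors. Nothing is divided by \<open>Y\<close>, so zeros do no
  harm. The error is measured by increments of \<open>G\<close>, which telescope.\<close>

lemma Y_dG_approx:
  assumes "0 < e"
  obtains \<eta> where "0 < \<eta>"
    "\<And>u v. 0 \<le> u \<Longrightarrow> u \<le> v \<Longrightarrow> v \<le> T \<Longrightarrow> v - u < \<eta> \<Longrightarrow>
      \<bar>(Y u + Y v) * (G v - G u) - k * (v - u)\<bar> \<le> e * (G v - G u)"
proof -
  obtain \<eta>1 where \<eta>1: "0 < \<eta>1"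
    "\<And>\<epsilon> u v. 0 < \<epsilon> \<Longrightarrow> 0 \<le> u \<Longrightarrow> u \<le> v \<Longrightarrow> v \<le> T \<Longrightarrow> v - u < \<eta>1 \<Longrightarrow> y \<epsilon> u - e / 4 \<le> y \<epsilon> v"
    using y_drop_small[of "e / 4" T] assms by (metis divide_pos_pos zero_less_numeral)
  obtain \<eta>2 where \<eta>2: "0 < \<eta>2"
    "\<And>u v. 0 \<le> u \<Longrightarrow> u \<le> v \<Longrightarrow> v \<le> T \<Longrightarrow> v - u < \<eta>2 \<Longrightarrow> \<bar>Y v - Y u\<bar> \<le> e / 2"
    using Y_uniform[of "e / 2" T] assms by (metis divide_pos_pos zero_less_numeral)
  show thesis
  proof (rule that)
    show "0 < min \<eta>1 \<eta>2" using \<eta>1 \<eta>2 by simp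
    fix u v :: real assume *: "0 \<le> u" "u \<le> v" "v \<le> T" "v - u < min \<eta>1 \<eta>2"
    \<comment> \<open>The estimate at hand limits drops of \<open>y \<epsilon>\<close>: an
      intermediate value is bounded below through the earlier time \<open>u\<close> and above
      through the later time \<open>v\<close>.\<close>
    have lower: "(y (eps n) u - e / 4) * (integral {u..v} (repulsion (eps n)) / 2) \<le> k / 2 * (v - u)"
      and upper: "k / 2 * (v - u) \<le> (Y v + e / 4 + eps n) * (integral {u..v} (repulsion (eps n)) / 2)"
      for n
    proof -
      define \<epsilon> where "\<epsilon> = eps n"
      have \<epsilon>: "0 < \<epsilon>" by (simp add: \<epsilon>_def del: of_nat_Suc)
      have rep: "k = (max (y \<epsilon> s) 0 + \<epsilon>) * repulsion \<epsilon> s" for s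
        using \<epsilon> by (simp add: repulsion_def add_nonneg_pos less_imp_neq[symmetric])
      have int: "(\<lambda>s. c * repulsion \<epsilon> s) integrable_on {u..v}" for c
        using * \<epsilon> by (intro integrable_on_mult_right integrable_repulsion) auto
      have "integral {u..v} (\<lambda>s. (y \<epsilon> u - e / 4) * repulsion \<epsilon> s) \<le> integral {u..v} (\<lambda>_. k)"
      proof (rule integral_le)
        fix s assume s: "s \<in> {u..v}"
        then have "y \<epsilon> u - e / 4 \<le> max (y \<epsilon> s) 0 + \<epsilon>" using \<eta>1(2)[of \<epsilon> u s] * \<epsilon> by auto
        then show "(y \<epsilon> u - e / 4) * repulsion \<epsilon> s \<le> k"
          using repulsion_pos[OF \<epsilon>, of s] rep[of s] by (metis less_imp_le mult_right_mono)
      qed (use int in auto)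
      then show "(y (eps n) u - e / 4) * (integral {u..v} (repulsion (eps n)) / 2) \<le> k / 2 * (v - u)"
        unfolding \<epsilon>_def[symmetric] using * by (simp add: mult.commute)
      have "integral {u..v} (\<lambda>_. k) \<le> integral {u..v} (\<lambda>s. (Y v + e / 4 + \<epsilon>) * repulsion \<epsilon> s)"
      proof (rule integral_le)
        fix s assume s: "s \<in> {u..v}"
        then have "max (y \<epsilon> s) 0 + \<epsilon> \<le> Y v + e / 4 + \<epsilon>"
          using \<eta>1(2)[of \<epsilon> s v] Y_tendsto(2)[of v \<epsilon>] Y_nonneg[of v] * \<epsilon> assms by auto
        then show "k \<le> (Y v + e / 4 + \<epsilon>) * repulsion \<epsilon> s"
          using repulsion_pos[OF \<epsilon>, of s] rep[of s] by (metis less_imp_le mult_right_mono)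
      qed (use int in auto)
      then show "k / 2 * (v - u) \<le> (Y v + e / 4 + eps n) * (integral {u..v} (repulsion (eps n)) / 2)"
        unfolding \<epsilon>_def[symmetric] using * by (simp add: mult.commute)
    qed
    have "(\<lambda>n. (y (eps n) u - e / 4) * (integral {u..v} (repulsion (eps n)) / 2))
        \<longlonglongrightarrow> (Y u - e / 4) * (G v - G u)"
      using * by (intro tendsto_intros y_eps_tendsto integral_repulsion_tendsto) auto
    then have l: "(Y u - e / 4) * (G v - G u) \<le> k / 2 * (v - u)"
      using lower by (intro LIMSEQ_le_const2) auto
    have "(\<lambda>n. (Y v + e / 4 + eps n) * (integral {u..v} (repulsion (eps n)) / 2))
        \<longlonglongrightarrow> (Y v + e / 4 + 0) * (G v - G u)"
      using * by (intro tendsto_intros LIMSEQ_inverse_real_of_nat integral_repulsion_tendsto) auto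
    then have r: "k / 2 * (v - u) \<le> (Y v + e / 4) * (G v - G u)"
      using upper by (intro LIMSEQ_le_const[where a = "k / 2 * (v - u)"]) auto
    \<comment> \<open>Doubling \<open>l\<close> or \<open>r\<close> costs \<open>e / 2\<close>;
      exchanging one endpoint value of \<open>Y\<close> for the other costs another
      \<open>e / 2\<close>.\<close>
    have "(Y v - Y u) * (G v - G u) \<le> e / 2 * (G v - G u)"
      and "(Y u - Y v) * (G v - G u) \<le> e / 2 * (G v - G u)"
      by (rule mult_right_mono; use \<eta>2(2)[of u v] G_mono[of u v] * in linarith)+
    moreover define \<Delta> where "\<Delta> = G v - G u"
    moreover have "k / 2 * (v - u) = k * (v - u) / 2" by simp
    ultimately show "\<bar>(Y u + Y v) * (G v - G u) - k * (v - u)\<bar> \<le> e * (G v - G u)"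
      using l r unfolding \<Delta>_def[symmetric] left_diff_distrib[of _ _ \<Delta>] distrib_right[of _ _ \<Delta>]
      by linarith
  qed
qed

section \<open>The Stratonovich integral of the limit path\<close>

lemma cont_Y2: "continuous_on {0..} (\<lambda>s. k - a * (Y s)\<^sup>2)"
  by (intro continuous_intros cont_Y)

text \<open>The increment of \<open>b\<close> is expressed through those of \<open>Y\<close>,
  \<open>G\<close> and the integral of \<open>Y\<close>. The midpoint factor turns the increment of
  \<open>Y\<close> into an exact difference of squares, and the rest matches the drift up to errors
  controlled by \<open>E\<close>. A general \<open>U\<close> allows \<open>sqrt (X s)\<close>, known
  to equal \<open>Y s\<close> for nonnegative times.\<close>

lemma has_stratonovich_integral_Y:
  assumes "0 \<le> u" and "u \<le> v" and U: "\<And>s. 0 \<le> s \<Longrightarrow> U s = Y s"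
  shows "has_stratonovich_integral U b u v
           (((Y v)\<^sup>2 - (Y u)\<^sup>2 - integral {u..v} (\<lambda>s. k - a * (Y s)\<^sup>2)) / \<sigma>)"
proof -
  define F where "F t = ((Y t)\<^sup>2 - integral {0..t} (\<lambda>s. k - a * (Y s)\<^sup>2)) / \<sigma>" for t
  define E where "E t = G t + integral {0..t} Y" for t
  have E_incr: "E t - E s = G t - G s + integral {s..t} Y" if "0 \<le> s" "s \<le> t" for s t
    using integral_Icc_diff[OF cont_Y that] by (simp add: E_def)
  have int_nonneg: "0 \<le> integral {s..t} Y" if "0 \<le> s" for s t
    using that by (intro integral_nonneg integrable_Y) (auto intro: Y_nonneg)
  have "has_stratonovich_integral U b u v (F v - F u)"
  proof (rule has_stratonovich_integral_telescope[where E = E, OF assms(2)])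
    show "E u \<le> E v" using E_incr[OF assms(1,2)] G_mono[OF assms(1,2)] int_nonneg[of u v] assms by simp
    fix e :: real assume "0 < e"
    \<comment> \<open>Chosen so that \<open>(1 + a) * e' / \<sigma> = e\<close>.\<close>
    define e' where "e' = e * \<sigma> / (1 + a)"
    have e': "0 < e'" using \<open>0 < e\<close> \<sigma>_pos a_pos by (simp add: e'_def)
    obtain \<eta>1 where \<eta>1: "0 < \<eta>1"
      "\<And>s t. 0 \<le> s \<Longrightarrow> s \<le> t \<Longrightarrow> t \<le> v \<Longrightarrow> t - s < \<eta>1 \<Longrightarrow> \<bar>Y t - Y s\<bar> \<le> e'"
      using Y_uniform[OF e', of v] by metis
    obtain \<eta>2 where \<eta>2: "0 < \<eta>2" "\<And>s t. 0 \<le> s \<Longrightarrow> s \<le> t \<Longrightarrow> t \<le> v \<Longrightarrow> t - s < \<eta>2 \<Longrightarrow>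
        \<bar>(Y s + Y t) * (G t - G s) - k * (t - s)\<bar> \<le> e' * (G t - G s)"
      using Y_dG_approx[OF e', of v] by metis
    have "\<bar>(U t + U s) / 2 * (b t - b s) - (F t - F s)\<bar> \<le> e * (E t - E s)"
      if st: "u \<le> s" "s \<le> t" "t \<le> v" "t - s < min \<eta>1 \<eta>2" for s t
    proof -
      have s0: "0 \<le> s" using st assms by simp
      define m where "m = (Y s + Y t) / 2"
      define \<Delta>G where "\<Delta>G = G t - G s"
      define IY where "IY = integral {s..t} Y"
      define IY2 where "IY2 = integral {s..t} (\<lambda>r. (Y r)\<^sup>2)"
      have int_Y2: "(\<lambda>r. (Y r)\<^sup>2) integrable_on {s..t}"
        by (intro integrable_continuous_interval continuous_intros continuous_on_subset[OF cont_Y])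
          (use s0 in auto)
      have "integral {s..t} (\<lambda>r. k - a * (Y r)\<^sup>2) = k * (t - s) - a * IY2"
        using integral_diff[OF integrable_const_ivl integrable_on_mult_right[OF int_Y2], of k a] st
        by (simp add: IY2_def)
      then have F_incr: "F t - F s = ((Y t)\<^sup>2 - (Y s)\<^sup>2 - (k * (t - s) - a * IY2)) / \<sigma>"
        using integral_Icc_diff[OF cont_Y2 s0 st(2)] by (simp add: F_def flip: diff_divide_distrib)
      have b_incr: "b t - b s = 2 / \<sigma> * (Y t - Y s + a / 2 * IY - \<Delta>G)"
        using G_increment[OF s0 st(2)] \<sigma>_pos by (simp add: IY_def \<Delta>G_def)
      \<comment> \<open>The product \<open>(Y s + Y t) * (Y t - Y s)\<close> cancels the difference
        of squares in \<open>F\<close>, leaving one damping error and one error from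
        \<open>G\<close>.\<close>
      have "(U t + U s) / 2 * (b t - b s) - (F t - F s) =
          (a * (m * IY - IY2) - ((Y s + Y t) * \<Delta>G - k * (t - s))) / \<sigma>"
        using U[of s] U[of t] s0 st(2) \<sigma>_pos unfolding F_incr b_incr m_def
        by (simp add: field_simps power2_eq_square)
      moreover have "\<bar>m * IY - IY2\<bar> \<le> e' * IY"
      proof -
        \<comment> \<open>\<open>Y r\<close> is within \<open>e'\<close> of both end values, hence
          of their mean \<open>m\<close>.\<close>
        have "\<bar>m - Y r\<bar> \<le> e'" if "r \<in> {s..t}" for r
          using \<eta>1(2)[of s r] \<eta>1(2)[of r t] st s0 that unfolding m_def
          by (auto simp: abs_le_iff field_simps)
        then have "norm (integral {s..t} (\<lambda>r. (m - Y r) * Y r)) \<le> integral {s..t} (\<lambda>r. e' * Y r)"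
          using s0 Y_nonneg
          by (intro integral_norm_bound_integral integrable_continuous_interval continuous_intros
              continuous_on_subset[OF cont_Y])
            (auto simp: abs_mult intro!: mult_right_mono)
        moreover have "integral {s..t} (\<lambda>r. (m - Y r) * Y r) = m * IY - IY2"
          using integral_diff[OF integrable_on_mult_right[OF integrable_Y[OF s0]] int_Y2, of m]
          by (simp add: IY_def IY2_def left_diff_distrib power2_eq_square)
        ultimately show ?thesis by (simp add: IY_def)
      qed
      then have "a * \<bar>m * IY - IY2\<bar> \<le> a * (e' * IY)" using a_pos by (intro mult_left_mono) auto
      then have "\<bar>a * (m * IY - IY2)\<bar> \<le> a * (e' * IY)" using a_pos by (simp add: abs_mult)
      moreover have "\<bar>(Y s + Y t) * \<Delta>G - k * (t - s)\<bar> \<le> e' * \<Delta>G"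
        unfolding \<Delta>G_def using st s0 by (intro \<eta>2) auto
      ultimately have "\<bar>(U t + U s) / 2 * (b t - b s) - (F t - F s)\<bar> \<le>
          (a * (e' * IY) + e' * \<Delta>G) / \<sigma>"
        using \<sigma>_pos by (simp add: divide_right_mono)
      \<comment> \<open>Adding the nonnegative terms \<open>e' * IY\<close> and
        \<open>a * (e' * \<Delta>G)\<close> produces a multiple of \<open>IY + \<Delta>G\<close>,
        the increment of \<open>E\<close>.\<close>
      also have "a * (e' * IY) + e' * \<Delta>G \<le> (1 + a) * e' * (IY + \<Delta>G)"
      proof -
        have "0 \<le> e' * IY" "0 \<le> a * (e' * \<Delta>G)"
          using e' a_pos G_mono[OF s0 st(2)] int_nonneg[OF s0, of t] by (auto simp: IY_def \<Delta>G_def)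
        then show ?thesis by (simp add: distrib_left distrib_right)
      qed
      also have "(1 + a) * e' * (IY + \<Delta>G) / \<sigma> = e * (E t - E s)"
      proof -
        have "(1 + a) * e' = e * \<sigma>" using a_pos by (simp add: e'_def)
        then show ?thesis using \<sigma>_pos E_incr[OF s0 st(2)] by (simp add: IY_def \<Delta>G_def)
      qed
      finally show ?thesis using \<sigma>_pos by (simp add: divide_right_mono)
    qed
    then show "\<exists>\<delta>>0. \<forall>s t. u \<le> s \<and> s \<le> t \<and> t \<le> v \<and> t - s < \<delta> \<longrightarrow>
        \<bar>(U t + U s) / 2 * (b t - b s) - (F t - F s)\<bar> \<le> e * (E t - E s)"
      using \<eta>1(1) \<eta>2(1) by (intro exI[of _ "min \<eta>1 \<eta>2"]) auto
  qed
  also have "F v - F u = ((Y v)\<^sup>2 - (Y u)\<^sup>2 - integral {u..v} (\<lambda>s. k - a * (Y s)\<^sup>2)) / \<sigma>"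
    using integral_Icc_diff[OF cont_Y2 assms(1,2)] by (simp add: F_def flip: diff_divide_distrib)
  finally show ?thesis .
qed

section \<open>Excursions of the limit path before a given zero\<close>

text \<open>The zero set is closed, so its infimum is attained; it is not 0 because
  \<open>Y 0 = Y0\<close> is positive.\<close>

lemma first_zero_Y:
  assumes "0 \<le> t" and "Y t = 0"
  shows "0 < first_zero Y" and "Y (first_zero Y) = 0" and "first_zero Y \<le> t"
proof -
  define Z where "Z = {s. 0 \<le> s \<and> Y s = 0}"
  have "closed {s \<in> {0..}. Y s = 0}"
    by (rule continuous_closed_preimage_constant[OF cont_Y]) auto
  moreover have "{s \<in> {0..}. Y s = 0} = Z" by (auto simp: Z_def)
  ultimately have "closed Z" by simp
  moreover have "t \<in> Z" and bdd: "bdd_below Z" using assms by (auto simp: Z_def)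
  ultimately have "Inf Z \<in> Z" by (intro closed_contains_Inf) auto
  moreover have "first_zero Y = Inf Z" by (simp add: first_zero_def Z_def)
  ultimately have "0 \<le> first_zero Y" and *: "Y (first_zero Y) = 0" and "first_zero Y \<le> t"
    using cInf_lower[OF \<open>t \<in> Z\<close> bdd] by (auto simp: Z_def)
  moreover have "first_zero Y \<noteq> 0" using * Y_0 Y0_pos by auto
  ultimately show "0 < first_zero Y" "Y (first_zero Y) = 0" "first_zero Y \<le> t" by auto
qed

lemma first_zero_le:
  assumes "0 \<le> t" and "Y t = 0"
  shows "first_zero Y \<le> t"
  using first_zero_Y[OF assms] by simp

text \<open>The excursion around \<open>s\<close> runs from the last zero before \<open>s\<close> to
  the first zero after it; the zeros \<open>l\<close> and \<open>r\<close> confine it.\<close>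

lemma excursion_exists:
  assumes "0 \<le> l" and "Y l = 0" and "l < s" and "s < r" and "Y r = 0" and "0 < Y s"
  obtains u v where "(u, v) \<in> excursions Y" "l \<le> u" "u < s" "s < v" "v \<le> r"
proof -
  have "continuous_on {l..s} (\<lambda>x. - Y x)" "continuous_on {l..s} Y"
    by (intro continuous_intros continuous_on_subset[OF cont_Y]; use assms in auto)+
  then obtain u where u: "l \<le> u" "u < s" "Y u = 0" "\<And>x. u < x \<Longrightarrow> x \<le> s \<Longrightarrow> 0 < Y x"
    using last_crossing[of l s Y 0] assms by (metis less_imp_le order_refl)
  \<comment> \<open>Time reversal turns the first zero after \<open>s\<close> into a last
    crossing.\<close>
  have "continuous_on {-r..-s} (\<lambda>x. Y (- x))"
    by (rule continuous_on_compose2[OF cont_Y]) (use assms in \<open>auto intro!: continuous_intros\<close>)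
  then obtain w where w: "- r \<le> w" "w < - s" "Y (- w) = 0"
    "\<And>x. w < x \<Longrightarrow> x \<le> - s \<Longrightarrow> 0 < Y (- x)"
    using last_crossing[of "- r" "- s" "\<lambda>x. Y (- x)" 0] assms by auto
  have "0 < Y x" if "u < x" "x < - w" for x
    using u(4)[of x] w(4)[of "- x"] that by (cases "x \<le> s") auto
  then have "(u, - w) \<in> excursions Y"
    using u w assms(1) by (subst excursions_iff[OF Y_nonneg]) auto
  then show thesis using that[of u "- w"] u w by auto
qed

text \<open>These excursions are disjoint and fill the positivity set between the first zero and
  \<alpha>; the zeros left out form a null set, so countable additivity yields the whole
  integral.\<close>

lemma has_sum_excursions_before:
  fixes f :: "real \<Rightarrow> real"
  assumes \<alpha>: "0 \<le> \<alpha>" "Y \<alpha> = 0" and cont: "continuous_on {0..} f"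
  shows "((\<lambda>(u, v). integral {u..v} f) has_sum integral {first_zero Y..\<alpha>} f)
    (excursions_before Y \<alpha>)"
proof -
  let ?\<beta> = "first_zero Y" and ?J = "excursions_before Y \<alpha>"
  define I where "I = (\<lambda>(u::real, v). {u<..<v})"
  note \<beta> = first_zero_Y[OF \<alpha>]
  have J: "?\<beta> \<le> u \<and> u < v \<and> v \<le> \<alpha> \<and> (\<forall>s\<in>{u<..<v}. 0 < Y s)" if "(u, v) \<in> ?J" for u v
  proof -
    have uv: "0 \<le> u" "u < v" "Y u = 0" "\<forall>s\<in>{u<..<v}. 0 < Y s" "u < \<alpha>"
      using that by (auto simp: excursions_before_def excursions_iff[OF Y_nonneg])
    \<comment> \<open>Otherwise the zero \<alpha> would lie inside the excursion.\<close>
    moreover have "v \<le> \<alpha>" using uv(4,5) \<alpha>(2) by force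
    ultimately show ?thesis using first_zero_le[of u] by auto
  qed
  have disj: "disjoint_family_on I ?J"
    unfolding disjoint_family_on_def
  proof (intro ballI impI)
    fix p q assume "p \<in> ?J" "q \<in> ?J" "p \<noteq> q"
    moreover obtain u v u' v' where pq: "p = (u, v)" "q = (u', v')" by fastforce
    ultimately have *: "(u, v) \<in> excursions Y" "(u', v') \<in> excursions Y" "(u, v) \<noteq> (u', v')"
      by (auto simp: excursions_before_def)
    consider "u < u'" | "u' < u" | "u = u'" "v < v'" | "u = u'" "v' < v" using *(3) by fastforce
    then show "I p \<inter> I q = {}"
    proof cases
      case 1
      then show ?thesis using excursions_disjoint[OF Y_nonneg *(1,2)] by (auto simp: pq I_def)
    next
      case 2
      then show ?thesis using excursions_disjoint[OF Y_nonneg *(2,1)] by (auto simp: pq I_def)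
    next
      case 3
      \<comment> \<open>With a common left end, the nearer right end would be interior to the longer
        excursion, although \<open>Y\<close> vanishes there.\<close>
      then have "0 < Y v" using *(1,2) by (force simp: excursions_iff[OF Y_nonneg])
      moreover have "Y v = 0" using *(1) by (simp add: excursions_iff[OF Y_nonneg])
      ultimately show ?thesis by simp
    next
      case 4
      then have "0 < Y v'" using *(1,2) by (force simp: excursions_iff[OF Y_nonneg])
      moreover have "Y v' = 0" using *(2) by (simp add: excursions_iff[OF Y_nonneg])
      ultimately show ?thesis by simp
    qed
  qed
  \<comment> \<open>A disjoint family of open subsets of the line is countable; disjointness and
    nonemptiness make \<open>I\<close> injective.\<close>
  have "countable ?J"
  proof (rule countable_image_inj_on)
    have ne: "I p \<noteq> {}" if "p \<in> ?J" for p
      using J[of "fst p" "snd p"] that by (simp add: I_def split_beta)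
    have "pairwise disjnt (I ` ?J)"
    proof (rule pairwiseI)
      fix A B assume "A \<in> I ` ?J" "B \<in> I ` ?J" "A \<noteq> B"
      then obtain p q where "p \<in> ?J" "q \<in> ?J" "A = I p" "B = I q" "p \<noteq> q" by (metis imageE)
      then show "disjnt A B" using disj by (simp add: disjnt_def disjoint_family_on_def)
    qed
    then show "countable (I ` ?J)"
      by (intro countable_disjoint_open_subsets) (auto simp: I_def)
    show "inj_on I ?J"
      using disj ne unfolding inj_on_def disjoint_family_on_def by (metis inf.idem)
  qed
  have Un: "(\<Union>p\<in>?J. I p) = {s \<in> {?\<beta>..\<alpha>}. 0 < Y s}"
  proof (intro equalityI subsetI)
    fix s assume s: "s \<in> {s \<in> {?\<beta>..\<alpha>}. 0 < Y s}"
    then have "?\<beta> < s" "s < \<alpha>" using \<beta>(2) \<alpha>(2) by (auto simp: less_le)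
    then obtain u v where "(u, v) \<in> excursions Y" "?\<beta> \<le> u" "u < s" "s < v" "v \<le> \<alpha>"
      using excursion_exists[of ?\<beta> s \<alpha>] \<beta> \<alpha> s by auto
    then show "s \<in> (\<Union>p\<in>?J. I p)"
      by (intro UN_I[of "(u, v)"]) (auto simp: excursions_before_def I_def)
  qed (use J in \<open>fastforce simp: I_def\<close>)
  have int: "set_integrable lborel {?\<beta>..\<alpha>} f"
    by (intro borel_integrable_atLeastAtMost' continuous_on_subset[OF cont]) (use \<beta> in auto)
  have "open (\<Union>p\<in>?J. I p)" by (auto simp: I_def)
  then have Un_meas: "(\<Union>p\<in>?J. I p) \<in> sets lborel" by simp
  then have int_Un: "set_integrable lborel (\<Union>p\<in>?J. I p) f"
    by (rule set_integrable_subset[OF int]) (auto simp: Un)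
  have "((\<lambda>p. LBINT s:I p. f s) has_sum (LBINT s:(\<Union>p\<in>?J. I p). f s)) ?J"
    by (rule has_sum_integral_disjoint[OF \<open>countable ?J\<close> _ disj int_Un]) (auto simp: I_def)
  also have "(LBINT s:(\<Union>p\<in>?J. I p). f s) = (LBINT s:{?\<beta>..\<alpha>}. f s)"
  proof (rule set_integral_cong_set)
    have "Y s = 0" if "?\<beta> \<le> s" "\<not> 0 < Y s" for s
      using that \<beta>(1) Y_nonneg[of s] by simp
    then have "{?\<beta>..\<alpha>} - (\<Union>p\<in>?J. I p) \<subseteq> {s \<in> {0..\<alpha>}. Y s = 0}"
      unfolding Un using \<beta>(1) by auto
    then have "negligible ({?\<beta>..\<alpha>} - (\<Union>p\<in>?J. I p))"
      by (rule negligible_subset[OF negligible_zeros])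
    \<comment> \<open>Negligibility refers to the completed measure; it passes to
      \<open>lborel\<close> because the set is Borel.\<close>
    then have "{?\<beta>..\<alpha>} - (\<Union>p\<in>?J. I p) \<in> null_sets lborel"
      using Un_meas by (simp add: negligible_iff_null_sets null_sets_completion_iff)
    then have "AE s in lborel. s \<notin> {?\<beta>..\<alpha>} - (\<Union>p\<in>?J. I p)" by (rule AE_not_in)
    then show "AE s in lborel. (s \<in> {?\<beta>..\<alpha>}) = (s \<in> (\<Union>p\<in>?J. I p))"
      by eventually_elim (use Un in blast)
  qed (use int int_Un in \<open>auto simp: set_integrable_def set_borel_measurable_def\<close>)
  also have "(LBINT s:{?\<beta>..\<alpha>}. f s) = integral {?\<beta>..\<alpha>} f"
    by (intro set_lebesgue_integral_eq_integral_Icc continuous_on_subset[OF cont]) (use \<beta> in auto)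
  finally have "((\<lambda>p. LBINT s:I p. f s) has_sum integral {?\<beta>..\<alpha>} f) ?J" .
  moreover have "(LBINT s:I p. f s) = (case p of (u, v) \<Rightarrow> integral {u..v} f)" if "p \<in> ?J" for p
  proof -
    obtain u v where p: "p = (u, v)" by fastforce
    then have uv: "?\<beta> \<le> u" "u < v" using J that by auto
    have "set_integrable lborel {u..v} f"
      by (intro borel_integrable_atLeastAtMost' continuous_on_subset[OF cont]) (use \<beta> uv in auto)
    then have "set_integrable lborel {u<..<v} f" by (rule set_integrable_subset) auto
    then show ?thesis
      using set_borel_integral_eq_integral(2)[of "{u<..<v}" f]
      by (simp add: p I_def integral_open_interval_real)
  qed
  ultimately show ?thesis by (subst (asm) has_sum_cong) auto
qed

text \<open>Boundary terms decide: up to the first zero they give \<open>- Y0^2\<close>, a complete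
  excursion gives none since \<open>Y\<close> vanishes at both ends, and the last piece gives
  \<open>(Y t)^2\<close>. The drift integrals of all pieces add up to the one over
  \<open>{0..t}\<close>.\<close>

lemma integral_equation_on_excursion:
  assumes \<alpha>\<beta>: "(\<alpha>, \<beta>) \<in> excursions Y" and t: "t \<in> {\<alpha>..\<beta>}" and X: "\<And>s. 0 \<le> s \<Longrightarrow> X s = (Y s)\<^sup>2"
  shows "set_integrable lborel {0..t} (\<lambda>s. k - a * X s)"
    and "stratonovich_integrable_over (\<lambda>s. sqrt (X s)) b (first_zero Y) (excursions_before Y \<alpha>) \<alpha> t"
    and "X t = X 0 + (LBINT s:{0..t}. k - a * X s) +
      \<sigma> * stratonovich_integral_over (\<lambda>s. sqrt (X s)) b (first_zero Y) (excursions_before Y \<alpha>) \<alpha> t"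
proof -
  let ?f = "\<lambda>s. k - a * (Y s)\<^sup>2" and ?U = "\<lambda>s. sqrt (X s)"
  let ?\<beta> = "first_zero Y" and ?J = "excursions_before Y \<alpha>"
  have \<alpha>: "0 \<le> \<alpha>" "Y \<alpha> = 0" using \<alpha>\<beta> by (auto simp: excursions_iff[OF Y_nonneg])
  then have t0: "0 \<le> t" "\<alpha> \<le> t" using t by auto
  note \<beta> = first_zero_Y[OF \<alpha>]
  have U: "?U s = Y s" if "0 \<le> s" for s using X that Y_nonneg by simp
  note strat = stratonovich_integral_eqI[OF has_stratonovich_integral_Y[OF _ _ U]]
  have "continuous_on {0..t} ?f" by (rule continuous_on_subset[OF cont_Y2]) auto
  then have "continuous_on {0..t} (\<lambda>s. k - a * X s)" by (rule continuous_on_eq) (simp add: X)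
  then show "set_integrable lborel {0..t} (\<lambda>s. k - a * X s)"
    by (rule borel_integrable_atLeastAtMost')
  have "(LBINT s:{0..t}. k - a * X s) = integral {0..t} (\<lambda>s. k - a * X s)"
    by (rule set_lebesgue_integral_eq_integral_Icc) fact
  also have "\<dots> = integral {0..t} ?f" by (rule integral_cong) (simp add: X)
  also have "\<dots> = integral {0..?\<beta>} ?f + integral {?\<beta>..\<alpha>} ?f + integral {\<alpha>..t} ?f"
    using integral_Icc_diff[OF cont_Y2, of ?\<beta> \<alpha>] integral_Icc_diff[OF cont_Y2 \<alpha>(1) t0(2)] \<beta> by simp
  finally have drift: "(LBINT s:{0..t}. k - a * X s) =
      integral {0..?\<beta>} ?f + integral {?\<beta>..\<alpha>} ?f + integral {\<alpha>..t} ?f" .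
  have J: "0 \<le> u" "u \<le> v" "Y u = 0" "Y v = 0" if "(u, v) \<in> ?J" for u v
    using that by (auto simp: excursions_before_def excursions_iff[OF Y_nonneg])
  \<comment> \<open>Without boundary terms each excursion integral is \<open>- 1 / \<sigma>\<close>
    times its drift integral, so summability is inherited from the drift.\<close>
  have "((\<lambda>p. - 1 / \<sigma> * (case p of (u, v) \<Rightarrow> integral {u..v} ?f)) has_sum
      - 1 / \<sigma> * integral {?\<beta>..\<alpha>} ?f) ?J"
    by (intro has_sum_cmult_right has_sum_excursions_before \<alpha> cont_Y2)
  moreover have "- 1 / \<sigma> * (case p of (u, v) \<Rightarrow> integral {u..v} ?f) =
      (case p of (u, v) \<Rightarrow> stratonovich_integral ?U b u v)" if "p \<in> ?J" for p
  proof -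
    obtain u v where "p = (u, v)" by fastforce
    then show ?thesis using J[of u v] that by (simp add: strat)
  qed
  ultimately have has_sum:
    "((\<lambda>(u, v). stratonovich_integral ?U b u v) has_sum - 1 / \<sigma> * integral {?\<beta>..\<alpha>} ?f) ?J"
    by (subst (asm) has_sum_cong) auto
  then show "stratonovich_integrable_over ?U b ?\<beta> ?J \<alpha> t"
    using J \<alpha> t0 \<beta> unfolding stratonovich_integrable_over_def
    by (auto intro!: strat(2) has_sum_imp_summable)
  show "X t = X 0 + (LBINT s:{0..t}. k - a * X s) +
      \<sigma> * stratonovich_integral_over ?U b ?\<beta> ?J \<alpha> t"
    using strat(1)[of 0 ?\<beta>] strat(1)[OF \<alpha>(1) t0(2)] infsumI[OF has_sum] \<alpha> \<beta> t0 \<sigma>_pos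
    by (simp add: stratonovich_integral_over_def drift X Y_0 field_simps)
qed

end

theorem theorem5p2:
  fixes M :: "'a measure" and H Y0 k a \<sigma> :: real
    and B :: "real \<Rightarrow> 'a \<Rightarrow> real"
    and Yeps :: "real \<Rightarrow> real \<Rightarrow> 'a \<Rightarrow> real"
    and Y X :: "real \<Rightarrow> 'a \<Rightarrow> real"
  assumes "prob_space M"
    and "0 < H" and "H < 1 / 2"
    and "fractional_brownian_motion M H B"
    and "0 < Y0" and "0 < k" and "0 < a" and "0 < \<sigma>"
    and "\<And>\<epsilon> \<omega>. 0 < \<epsilon> \<Longrightarrow> \<omega> \<in> space M \<Longrightarrow>
           regularized_solution Y0 k a \<sigma> \<epsilon> (\<lambda>t. B t \<omega>) (\<lambda>t. Yeps \<epsilon> t \<omega>)"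
    and "\<And>t \<omega>. 0 \<le> t \<Longrightarrow> \<omega> \<in> space M \<Longrightarrow> Y t \<omega> = Lim (at_right 0) (\<lambda>\<epsilon>. Yeps \<epsilon> t \<omega>)"
    and "\<And>t \<omega>. 0 \<le> t \<Longrightarrow> \<omega> \<in> space M \<Longrightarrow> X t \<omega> = (Y t \<omega>)\<^sup>2"
  shows "AE \<omega> in M. \<forall>\<alpha> \<beta> t. (\<alpha>, \<beta>) \<in> excursions (\<lambda>s. Y s \<omega>) \<and> t \<in> {\<alpha>..\<beta>} \<longrightarrow>
    set_integrable lborel {0..t} (\<lambda>s. k - a * X s \<omega>) \<and>
    stratonovich_integrable_over (\<lambda>s. sqrt (X s \<omega>)) (\<lambda>s. B s \<omega>)
      (first_zero (\<lambda>s. Y s \<omega>)) (excursions_before (\<lambda>s. Y s \<omega>) \<alpha>) \<alpha> t \<and>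
    X t \<omega> = X 0 \<omega> + (LBINT s:{0..t}. k - a * X s \<omega>) +
      \<sigma> * stratonovich_integral_over (\<lambda>s. sqrt (X s \<omega>)) (\<lambda>s. B s \<omega>)
        (first_zero (\<lambda>s. Y s \<omega>)) (excursions_before (\<lambda>s. Y s \<omega>) \<alpha>) \<alpha> t"
proof (rule AE_I2)
  \<comment> \<open>The equation, the limit and the continuity of the noise are given at every
    sample point, so the pathwise result applies to each and no exceptional set arises.\<close>
  fix \<omega> assume \<omega>: "\<omega> \<in> space M"
  interpret regularized_limit Y0 k a \<sigma> "\<lambda>t. B t \<omega>" "\<lambda>\<epsilon> t. Yeps \<epsilon> t \<omega>" "\<lambda>t. Y t \<omega>"
    using assms(4-10) \<omega> by unfold_locales (auto simp: fractional_brownian_motion_def)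
  show "\<forall>\<alpha> \<beta> t. (\<alpha>, \<beta>) \<in> excursions (\<lambda>s. Y s \<omega>) \<and> t \<in> {\<alpha>..\<beta>} \<longrightarrow>
    set_integrable lborel {0..t} (\<lambda>s. k - a * X s \<omega>) \<and>
    stratonovich_integrable_over (\<lambda>s. sqrt (X s \<omega>)) (\<lambda>s. B s \<omega>)
      (first_zero (\<lambda>s. Y s \<omega>)) (excursions_before (\<lambda>s. Y s \<omega>) \<alpha>) \<alpha> t \<and>
    X t \<omega> = X 0 \<omega> + (LBINT s:{0..t}. k - a * X s \<omega>) +
      \<sigma> * stratonovich_integral_over (\<lambda>s. sqrt (X s \<omega>)) (\<lambda>s. B s \<omega>)
        (first_zero (\<lambda>s. Y s \<omega>)) (excursions_before (\<lambda>s. Y s \<omega>) \<alpha>) \<alpha> t"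
    using integral_equation_on_excursion[of _ _ _ "\<lambda>t. X t \<omega>"] assms(11) \<omega> by blast
qed

end
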